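(* Let $K,q\in\mathbb{N}$ and let $\Psi_K^N$, $N\in\mathbb{N}$, be the directional wavelets with window function $\kappa\in C^{3q-1}([0,\infty))$. Then there exists a constant $c=c(\kappa,K,q)>0$, depending only on $\kappa$, $K$ and $q$, such that for all $N\in\mathbb{N}$ $$|\Psi_K^N(\theta,\varphi)|\le\frac{cN^2}{(1+N\theta)^q}\sum_{k=0}^{K-1}(N\sin\theta)^k\qquad\text{for all }\theta\in[0,\pi],\ \varphi\in[0,2\pi).$$ In particular, $$|\Psi_K^N(\theta,\varphi)|\le\frac{cN^2}{(1+N\theta)^{q+1-K}}\qquad\text{for all }\theta\in[0,\pi],\ \varphi\in[0,2\pi).$$ (The value of the constant $c=c(\kappa,K,q)$ may differ between the two estimates.)
   Context: Functions on the unit sphere $\mathbb{S}^2\subset\mathbb{R}^3$ are written in the coordinates $\mathbf{x}(\theta,\varphi)=(\sin\theta\cos\varphi,\sin\theta\sin\varphi,\cos\theta)^\top$, $\theta\in[0,\pi]$, $\varphi\in[0,2\pi)$. **Spherical harmonics.** For $n\in\mathbb{N}_0$, $|k|\le n$, $Y_n^k(\theta,\varphi)=(-1)^k\sqrt{\frac{2n+1}{4\pi}\frac{(n-k)!}{(n+k)!}}\,P_n^k(\cos\theta)e^{\mathrm{i}k\varphi}$, where $P_n^k(x)=(1-x^2)^{k/2}\frac{\mathrm{d}^k}{\mathrm{d}x^k}P_n(x)$ for $k\ge0$, $P_n^k=(-1)^k\frac{(n+k)!}{(n-k)!}P_n^{-k}$ for $k<0$, and $P_n(x)=\frac{1}{2^nn!}\frac{\mathrm{d}^n}{\mathrm{d}x^n}(x^2-1)^n$.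 **Directional wavelets.** The window function $\kappa:[0,\infty)\to\mathbb{R}$ satisfies $\emptyset\ne\mathrm{supp}(\kappa)\subset[1/2,2]$. For $K,N\in\mathbb{N}$, $$\Psi_K^N=\sum_{n=0}^\infty\sum_{k=-n}^n\sqrt{\tfrac{2n+1}{8\pi^2}}\,\kappa\!\left(\tfrac nN\right)\zeta_{n,k}^K\,Y_n^k,$$ where $\zeta_{n,k}^K=0$ if $|k|\ge K$ and $\zeta_{n,k}^K=\eta\,\nu\sqrt{2^{-p}\binom{p}{(p-k)/2}}$ if $|k|\le K-1$, with $\eta=1$ if $K-1$ is even and $\eta=\mathrm{i}$ if $K-1$ is odd; $\nu=1$ if $K+k$ is odd and $\nu=0$ if $K+k$ is even (so $\zeta^K_{n,k}=0$ then); $p=\min(K-1,n-1)$ if $K+n$ is even and $p=\min(K-1,n)$ if $K+n$ is odd. *)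

theory Defs
  imports "HOL-Analysis.Analysis"
begin

definition legendre :: "nat \<Rightarrow> real \<Rightarrow> real" where
  "legendre n x = 1 / (2 ^ n * fact n) * (deriv ^^ n) (\<lambda>t. (t\<^sup>2 - 1) ^ n) x"

(* The factor (1 - x^2)^(k/2) is written sqrt (1 - x^2) ^ k, since
   powr would give 0 instead of 1 at x = 1, -1 for k = 0. There is no
   Condon-Shortley phase here; it enters in sph_harm. *)
definition assoc_legendre_nonneg :: "nat \<Rightarrow> nat \<Rightarrow> real \<Rightarrow> real" where
  "assoc_legendre_nonneg n k x = sqrt (1 - x\<^sup>2) ^ k * (deriv ^^ k) (legendre n) x"

(* Only meaningful for \<bar>k\<bar> \<le> n, where the arguments of nat are nonnegative. *)
definition assoc_legendre :: "nat \<Rightarrow> int \<Rightarrow> real \<Rightarrow> real" where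
  "assoc_legendre n k x =
     (if 0 \<le> k then assoc_legendre_nonneg n (nat k) x
      else (-1) powi k * (fact (nat (int n + k)) / fact (nat (int n - k)))
             * assoc_legendre_nonneg n (nat (- k)) x)"

(* Functions on the sphere are given in the coordinates
   (sin \<theta> cos \<phi>, sin \<theta> sin \<phi>, cos \<theta>). *)
definition sph_harm :: "nat \<Rightarrow> int \<Rightarrow> real \<Rightarrow> real \<Rightarrow> complex" where
  "sph_harm n k \<theta> \<phi> =
     complex_of_real
       ((-1) powi k
        * sqrt ((2 * real n + 1) / (4 * pi) * (fact (nat (int n - k)) / fact (nat (int n + k))))
        * assoc_legendre n k (cos \<theta>))
     * exp (\<i> * of_int k * complex_of_real \<phi>)"

(* p is an integer because it equals -1 when n = 0 and K is even. For \<bar>k\<bar> \<le> n,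
   whenever \<bar>k\<bar> < K and \<nu> \<noteq> 0 one has \<bar>k\<bar> \<le> p with p - k even, so that nat and
   div do not truncate. *)
definition dir_coeff :: "nat \<Rightarrow> nat \<Rightarrow> int \<Rightarrow> complex" where
  "dir_coeff K n k =
     (if int K \<le> \<bar>k\<bar> then 0
      else
        let \<eta> = (if even (int K - 1) then 1 else \<i>);
            \<nu> = (if odd (int K + k) then 1 else 0 :: real);
            p = (if even (K + n) then min (int K - 1) (int n - 1) else min (int K - 1) (int n))
        in \<eta> * complex_of_real
             (\<nu> * sqrt (2 powi (- p) * real (nat p choose nat ((p - k) div 2)))))"

(* For window functions with support in [1/2, 2], the terms with n > 2 N vanish,
   so the series is a finite sum. *)
definition dir_wavelet :: "(real \<Rightarrow> real) \<Rightarrow> nat \<Rightarrow> nat \<Rightarrow> real \<Rightarrow> real \<Rightarrow> complex" where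
  "dir_wavelet \<kappa> K N \<theta> \<phi> =
     (\<Sum>n. \<Sum>k = - int n..int n.
        complex_of_real (sqrt ((2 * real n + 1) / (8 * pi\<^sup>2)) * \<kappa> (real n / real N))
        * dir_coeff K n k * sph_harm n k \<theta> \<phi>)"

(* f is of class C^m on S, with derivatives relative to S (one-sided at boundary
   points of an interval S). Only the values of f on S matter. *)
definition Cm_on :: "nat \<Rightarrow> real set \<Rightarrow> (real \<Rightarrow> real) \<Rightarrow> bool" where
  "Cm_on m S f \<longleftrightarrow>
     (\<exists>D :: nat \<Rightarrow> real \<Rightarrow> real. D 0 = f
        \<and> (\<forall>j<m. \<forall>x\<in>S. (D j has_real_derivative D (Suc j) x) (at x within S))
        \<and> continuous_on S (D m))"

end

theory Submission
  imports Defs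
begin

text \<open>For \<open>n \<ge> K\<close> the directionality coefficients do not depend on \<open>n\<close>, so for \<open>N \<ge> 2 K\<close> the wavelet
  is a fixed combination of \<open>sin\<^sup>k \<theta>\<close> times sums \<open>\<Sum>n. (2 n + 1) a n P\<^sub>n\<^bsup>(k)\<^esup>(cos \<theta>)\<close> with
  \<open>k < K\<close> and \<open>a n = \<kappa>(n / N) ((n - k)! / (n + k)!)\<^bsup>1/2\<^esup>\<close>. The three-term recurrence turns multiplication
  by \<open>1 - cos \<theta>\<close> into a second-order difference operator on \<open>a\<close>, which gains a factor \<open>N\<^bsup>-2\<^esup>\<close>
  since \<open>N\<^sup>k a\<close> is smooth at scale \<open>N\<close>. Applying it \<open>\<lceil>q/2\<rceil>\<close> times and bounding
  \<open>|P\<^sub>n\<^bsup>(k)\<^esup>| \<le> n\<^bsup>2k\<^esup>\<close> termwise gives the decay, because \<open>1 - cos \<theta> \<ge> 2 \<theta>\<^sup>2 / \<pi>\<^sup>2\<close>. The finitely many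
  remaining \<open>N\<close> are absorbed into the constant.\<close>

section \<open>Derivatives of Legendre polynomials\<close>

text \<open>Normalised so that the derivative of \<open>rodrigues_poly (Suc n)\<close> is exactly
  \<open>x\<close> times \<open>rodrigues_poly n\<close>. All Legendre identities below come from
  differentiating two relations between neighbouring members of this family.\<close>

definition rodrigues_poly :: "nat \<Rightarrow> real poly" where
  "rodrigues_poly n = smult (1 / (2 ^ n * fact n)) ([:-1, 0, 1:] ^ n)"

definition legendre_poly :: "nat \<Rightarrow> real poly" where
  "legendre_poly n = (pderiv ^^ n) (rodrigues_poly n)"

lemma deriv_iter_poly: "(deriv ^^ n) (poly p) = poly ((pderiv ^^ n) p)" for p :: "real poly"
proof (induction n)
  case (Suc n)
  have "deriv (poly q) = poly (pderiv q)" for q :: "real poly"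
    by (rule ext) (rule DERIV_imp_deriv, rule poly_DERIV)
  with Suc show ?case by simp
qed simp

lemma real_poly_eqI: "(\<And>x. poly p x = poly q x) \<Longrightarrow> p = q" for p q :: "real poly"
  by (simp add: poly_eq_poly_eq_iff[symmetric] fun_eq_iff)

lemma legendre_eq_poly: "legendre n = poly (legendre_poly n)"
proof
  fix x
  have "(\<lambda>t::real. (t\<^sup>2 - 1) ^ n) = poly ([:-1, 0, 1:] ^ n)"
    by (simp add: fun_eq_iff power2_eq_square)
  then show "legendre n x = poly (legendre_poly n) x"
    by (simp only: legendre_def legendre_poly_def rodrigues_poly_def deriv_iter_poly
        higher_pderiv_smult poly_smult)
qed

text \<open>Leibniz' rule, in which only two terms survive because the factor is linear. Taking
  \<open>pderiv p\<close> as the other factor avoids an \<open>(n - 1)\<close>-st derivative; the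
  next lemma differentiates \<open>Suc n\<close> times for the same reason.\<close>

lemma higher_pderiv_X_mult_pderiv:
  "(pderiv ^^ n) ([:0, 1:] * pderiv p)
     = [:0, 1:] * (pderiv ^^ Suc n) p + smult (real n) ((pderiv ^^ n) p)"
proof (induction n)
  case (Suc n)
  have "smult (real (Suc n)) r = r + smult (real n) r" for r :: "real poly"
    by (rule real_poly_eqI) (simp add: algebra_simps)
  with Suc show ?case
    by (simp add: pderiv_add pderiv_smult pderiv_pCons add_ac)
qed simp

lemma higher_pderiv_X_mult:
  "(pderiv ^^ Suc n) ([:0, 1:] * p)
     = [:0, 1:] * (pderiv ^^ Suc n) p + smult (real n + 1) ((pderiv ^^ n) p)"
proof (induction n)
  case (Suc n)
  have "smult (real (Suc n) + 1) r = r + smult (real n + 1) r" for r :: "real poly"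
    by (rule real_poly_eqI) (simp add: algebra_simps)
  with Suc show ?case
    by (simp add: pderiv_add pderiv_smult pderiv_pCons add_ac)
qed (simp add: pderiv_pCons)

lemma pderiv_rodrigues_poly: "pderiv (rodrigues_poly (Suc n)) = [:0, 1:] * rodrigues_poly n"
proof -
  have "pderiv ([:-1, 0, 1:] ^ Suc n) = smult (2 * real (Suc n)) ([:0, 1:] * [:-1, 0, 1:] ^ n)"
    by (subst pderiv_power_Suc) (simp add: pderiv_pCons)
  then show ?thesis
    by (intro real_poly_eqI) (simp add: rodrigues_poly_def pderiv_smult divide_simps del: power_Suc,
        simp add: algebra_simps)
qed

text \<open>Write x^2 = (x^2 - 1) + 1 in x^2 times \<open>rodrigues_poly n\<close>; the factor x^2 -
  1 raises the index by one.\<close>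

lemma X_mult_pderiv_rodrigues_poly:
  "[:0, 1:] * pderiv (rodrigues_poly (Suc n))
     = smult (2 * real (Suc n)) (rodrigues_poly (Suc n)) + rodrigues_poly n"
proof -
  have "[:0, 1:] * ([:0, 1:] * rodrigues_poly n) = [:-1, 0, 1:] * rodrigues_poly n + rodrigues_poly n"
    by (simp add: algebra_simps)
  also have "[:-1, 0, 1:] * rodrigues_poly n = smult (2 * real (Suc n)) (rodrigues_poly (Suc n))"
    by (rule real_poly_eqI) (simp add: rodrigues_poly_def divide_simps)
  finally show ?thesis by (simp only: pderiv_rodrigues_poly)
qed

text \<open>The antiderivative of \<open>legendre_poly (Suc n)\<close> that vanishes at both end
  points. It is the auxiliary quantity eliminated between \<open>legendre_poly_up\<close> and
  \<open>legendre_poly_down\<close>.\<close>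

definition legendre_primitive :: "nat \<Rightarrow> real poly" where
  "legendre_primitive n = (pderiv ^^ n) (rodrigues_poly (Suc n))"

lemma pderiv_legendre_primitive: "pderiv (legendre_primitive n) = legendre_poly (Suc n)"
  by (simp add: legendre_primitive_def legendre_poly_def)

lemma legendre_poly_0 [simp]: "legendre_poly 0 = 1"
  by (simp add: legendre_poly_def rodrigues_poly_def)

lemma legendre_poly_1 [simp]: "legendre_poly (Suc 0) = [:0, 1:]"
  by (simp add: legendre_poly_def rodrigues_poly_def pderiv_smult pderiv_pCons)

lemma legendre_poly_up:
  "legendre_poly (Suc (Suc n))
     = [:0, 1:] * legendre_poly (Suc n) + smult (real n + 1) (legendre_primitive n)"
proof -
  have "legendre_poly (Suc (Suc n)) = (pderiv ^^ Suc n) ([:0, 1:] * rodrigues_poly (Suc n))"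
    unfolding legendre_poly_def pderiv_rodrigues_poly[symmetric] funpow_Suc_right o_def ..
  then show ?thesis
    unfolding higher_pderiv_X_mult legendre_poly_def legendre_primitive_def .
qed

text \<open>Differentiate \<open>X_mult_pderiv_rodrigues_poly\<close> \<open>n\<close> times, once
  with Leibniz' rule and once termwise, and compare.\<close>

lemma legendre_poly_down:
  "legendre_poly n = [:0, 1:] * legendre_poly (Suc n) - smult (real n + 2) (legendre_primitive n)"
proof -
  have "(pderiv ^^ n) ([:0, 1:] * pderiv (rodrigues_poly (Suc n)))
      = [:0, 1:] * legendre_poly (Suc n) + smult (real n) (legendre_primitive n)"
    by (simp only: higher_pderiv_X_mult_pderiv legendre_poly_def legendre_primitive_def)
  moreover have "(pderiv ^^ n) ([:0, 1:] * pderiv (rodrigues_poly (Suc n)))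
      = smult (2 * real (Suc n)) (legendre_primitive n) + legendre_poly n"
    by (simp only: X_mult_pderiv_rodrigues_poly higher_pderiv_add higher_pderiv_smult
        legendre_poly_def legendre_primitive_def)
  ultimately have *: "[:0, 1:] * legendre_poly (Suc n) + smult (real n) (legendre_primitive n)
      = smult (2 * real (Suc n)) (legendre_primitive n) + legendre_poly n" by simp
  show ?thesis
  proof (rule real_poly_eqI)
    fix x
    show "poly (legendre_poly n) x
        = poly ([:0, 1:] * legendre_poly (Suc n) - smult (real n + 2) (legendre_primitive n)) x"
      using arg_cong[OF *, of "\<lambda>p. poly p x"] by (simp add: algebra_simps)
  qed
qed

lemma pderiv_legendre_poly_up:
  "pderiv (legendre_poly (Suc n)) = smult (real n + 1) (legendre_poly n) + [:0, 1:] * pderiv (legendre_poly n)"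
proof (cases n)
  case 0
  then show ?thesis by (simp add: pderiv_pCons)
next
  case (Suc m)
  show ?thesis
    unfolding Suc legendre_poly_up[of m]
    by (intro real_poly_eqI) (simp add: pderiv_add pderiv_smult pderiv_pCons
        pderiv_legendre_primitive algebra_simps)
qed

lemma pderiv_legendre_poly_down:
  "pderiv (legendre_poly n) = [:0, 1:] * pderiv (legendre_poly (Suc n)) - smult (real n + 1) (legendre_poly (Suc n))"
  unfolding legendre_poly_down[of n]
  by (rule real_poly_eqI) (simp add: pderiv_diff pderiv_smult pderiv_pCons
      pderiv_legendre_primitive algebra_simps)

text \<open>The upward and downward derivative relations share the term x P'_{n+1}, which is
  eliminated here.\<close>

lemma pderiv_legendre_poly_diff:
  "pderiv (legendre_poly (Suc (Suc n)))
     = pderiv (legendre_poly n) + smult (2 * real n + 3) (legendre_poly (Suc n))"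
  unfolding pderiv_legendre_poly_up[of "Suc n"] pderiv_legendre_poly_down[of n]
  by (rule real_poly_eqI) (simp add: algebra_simps)

lemma legendre_poly_bonnet:
  "smult (real n + 2) (legendre_poly (Suc (Suc n))) + smult (real n + 1) (legendre_poly n)
     = smult (2 * real n + 3) ([:0, 1:] * legendre_poly (Suc n))"
  unfolding legendre_poly_up[of n] legendre_poly_down[of n]
  by (rule real_poly_eqI) (simp add: algebra_simps)

text \<open>Legendre's differential equation integrated once. The factor x^2 - 1 shows that the
  primitive vanishes at 1 and -1.\<close>

lemma legendre_poly_ode_integrated:
  "[:-1, 0, 1:] * pderiv (legendre_poly (Suc n))
     = smult ((real n + 1) * (real n + 2)) (legendre_primitive n)"
proof -
  have "[:-1, 0, 1:] * pderiv (legendre_poly (Suc n))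
     = [:0, 1:] * ([:0, 1:] * pderiv (legendre_poly (Suc n))) - pderiv (legendre_poly (Suc n))"
    by simp
  also have "[:0, 1:] * pderiv (legendre_poly (Suc n))
      = pderiv (legendre_poly n) + smult (real n + 1) (legendre_poly (Suc n))"
    by (simp add: pderiv_legendre_poly_down[of n])
  also have "[:0, 1:] * \<dots> - pderiv (legendre_poly (Suc n))
      = smult (real n + 1) ([:0, 1:] * legendre_poly (Suc n) - legendre_poly n)"
    by (simp add: pderiv_legendre_poly_up[of n] smult_diff_right algebra_simps)
  also have "[:0, 1:] * legendre_poly (Suc n) - legendre_poly n = smult (real n + 2) (legendre_primitive n)"
    by (simp add: legendre_poly_down[of n])
  finally show ?thesis by simp
qed

section \<open>End-point values and the uniform bound on [-1, 1]\<close>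

lemma legendre_poly_at_1: "poly (legendre_poly n) 1 = 1"
proof (induction n)
  case (Suc n)
  have "(real n + 1) * (real n + 2) * poly (legendre_primitive n) 1 = 0"
    using arg_cong[OF legendre_poly_ode_integrated[of n], of "\<lambda>p. poly p 1"] by simp
  moreover have "(real n + 1) * (real n + 2) > 0" by simp
  ultimately have "poly (legendre_primitive n) 1 = 0"
    by (metis less_irrefl mult_eq_0_iff)
  then show ?case
    using Suc arg_cong[OF legendre_poly_down[of n], of "\<lambda>p. poly p 1"] by simp
qed simp

text \<open>At -1 the primitive vanishes, so \<open>legendre_poly_down\<close> makes the sign
  alternate with the degree; squaring discards the sign.\<close>

lemma legendre_poly_at_minus_1: "(poly (legendre_poly n) (-1))\<^sup>2 = 1"
proof (induction n)
  case (Suc n)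
  have "(real n + 1) * (real n + 2) * poly (legendre_primitive n) (-1) = 0"
    using arg_cong[OF legendre_poly_ode_integrated[of n], of "\<lambda>p. poly p (-1)"] by simp
  moreover have "(real n + 1) * (real n + 2) > 0" by simp
  ultimately have "poly (legendre_primitive n) (-1) = 0"
    by (metis less_irrefl mult_eq_0_iff)
  then show ?case
    using Suc arg_cong[OF legendre_poly_down[of n], of "\<lambda>p. poly p (-1)"] by simp
qed simp

text \<open>Sonin's function \<open>P\<^sup>2 + (1 - x\<^sup>2) P'\<^sup>2 / (n (n + 1))\<close> has derivative
  \<open>2 x P'\<^sup>2 / (n (n + 1))\<close>, so on \<open>[-1, 1]\<close> it is largest at the end points.\<close>

lemma legendre_poly_bound:
  assumes "\<bar>x\<bar> \<le> 1"
  shows "\<bar>poly (legendre_poly n) x\<bar> \<le> 1"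
proof (cases n)
  case (Suc m)
  define c where "c = (real m + 1) * (real m + 2)"
  have c: "c > 0" by (simp add: c_def)
  define P P' P'' where "P = poly (legendre_poly n)" and "P' = poly (pderiv (legendre_poly n))"
    and "P'' = poly (pderiv (pderiv (legendre_poly n)))"
  \<comment> \<open>Legendre's equation for degree \<open>n\<close>, from differentiating the
    integrated form; \<open>c\<close> is n (n + 1) because \<open>n\<close> is
    \<open>Suc m\<close>.\<close>
  have ode: "2 * t * P' t + (t\<^sup>2 - 1) * P'' t = c * P t" for t
  proof -
    have "pderiv ([:-1, 0, 1:] * pderiv (legendre_poly n)) = smult c (legendre_poly n)"
      by (simp only: Suc legendre_poly_ode_integrated pderiv_smult pderiv_legendre_primitive c_def)
    then have "[:0, 2:] * pderiv (legendre_poly n) + [:-1, 0, 1:] * pderiv (pderiv (legendre_poly n))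
        = smult c (legendre_poly n)"
      by (simp only: pderiv_mult pderiv_pCons) (simp add: algebra_simps)
    from arg_cong[OF this, of "\<lambda>p. poly p t"] show ?thesis
      by (simp add: P_def P'_def P''_def power2_eq_square algebra_simps)
  qed
  define f where "f t = (P t)\<^sup>2 + (1 - t\<^sup>2) * (P' t)\<^sup>2 / c" for t
  have D: "(P has_real_derivative P' t) (at t)" "(P' has_real_derivative P'' t) (at t)" for t
    by (simp_all add: P_def P'_def P''_def)
  have f': "(f has_real_derivative 2 * t * (P' t)\<^sup>2 / c) (at t)" for t
  proof -
    have "(f has_real_derivative
        2 * P t * P' t + ((- 2 * t) * (P' t)\<^sup>2 + (1 - t\<^sup>2) * (2 * P' t * P'' t)) / c) (at t)"
      unfolding f_def using c
      by (auto intro!: derivative_eq_intros D)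
    moreover
    have "2 * P t * P' t + ((- 2 * t) * (P' t)\<^sup>2 + (1 - t\<^sup>2) * (2 * P' t * P'' t)) / c
        = 2 * t * (P' t)\<^sup>2 / c"
    proof -
      have "(1 - t\<^sup>2) * P'' t = 2 * t * P' t - c * P t"
        using ode[of t] by (simp add: algebra_simps)
      then have "(- 2 * t) * (P' t)\<^sup>2 + (1 - t\<^sup>2) * (2 * P' t * P'' t)
          = 2 * t * (P' t)\<^sup>2 - c * (2 * P t * P' t)"
        by algebra
      then show ?thesis using c by (simp add: diff_divide_distrib)
    qed
    ultimately show ?thesis by simp
  qed
  have "f x \<le> 1"
  proof (cases "x \<ge> 0")
    case True
    then have "f x \<le> f 1"
      using assms
    proof (intro DERIV_nonneg_imp_nondecreasing[of x 1 f])
      fix t assume "x \<le> t"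
      then have "2 * t * (P' t)\<^sup>2 / c \<ge> 0" using True c by simp
      with f' show "\<exists>y. (f has_real_derivative y) (at t) \<and> 0 \<le> y" by blast
    qed simp
    then show ?thesis by (simp add: f_def P_def legendre_poly_at_1)
  next
    case False
    have "f x \<le> f (-1)"
      using assms
    proof (intro DERIV_nonpos_imp_nonincreasing[of "-1" x f])
      fix t assume "t \<le> x"
      then have "2 * t * (P' t)\<^sup>2 / c \<le> 0"
        using False c by (simp add: divide_nonpos_pos mult_nonpos_nonneg)
      with f' show "\<exists>y. (f has_real_derivative y) (at t) \<and> y \<le> 0" by blast
    qed simp
    then show ?thesis by (simp add: f_def P_def legendre_poly_at_minus_1)
  qed
  moreover have "0 \<le> (1 - x\<^sup>2) * (P' x)\<^sup>2 / c"
    using assms c by (simp add: abs_square_le_1)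
  ultimately have "(P x)\<^sup>2 \<le> 1" by (simp add: f_def)
  then show ?thesis by (simp add: P_def abs_square_le_1)
qed simp

section \<open>Higher derivatives: three-term recurrence and growth\<close>

definition legendre_deriv :: "nat \<Rightarrow> nat \<Rightarrow> real \<Rightarrow> real" where
  "legendre_deriv k n = poly ((pderiv ^^ k) (legendre_poly n))"

text \<open>Differentiating Bonnet's recurrence \<open>k\<close> times leaves, by Leibniz' rule,
  \<open>k\<close> times a derivative of order \<open>k - 1\<close>. The identity for P'_{n+2} -
  P'_n, differentiated \<open>k - 1\<close> times, expresses this term through derivatives of order
  \<open>k\<close>.\<close>

lemma legendre_deriv_recurrence:
  "(2 * real n + 3) * x * legendre_deriv k (Suc n) x
     = (real n + 2 - real k) * legendre_deriv k (Suc (Suc n)) x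
       + (real n + 1 + real k) * legendre_deriv k n x"
proof (cases k)
  case 0
  then show ?thesis
    using arg_cong[OF legendre_poly_bonnet[of n], of "\<lambda>p. poly p x"]
    by (simp add: legendre_deriv_def)
next
  case (Suc j)
  have "(pderiv ^^ k) (smult (real n + 2) (legendre_poly (Suc (Suc n))) + smult (real n + 1) (legendre_poly n))
     = smult (2 * real n + 3) ((pderiv ^^ Suc j) ([:0, 1:] * legendre_poly (Suc n)))"
    by (simp only: legendre_poly_bonnet higher_pderiv_smult Suc)
  from arg_cong[OF this[unfolded higher_pderiv_X_mult], of "\<lambda>p. poly p x"]
  have 1: "(real n + 2) * legendre_deriv k (Suc (Suc n)) x + (real n + 1) * legendre_deriv k n x
    = (2 * real n + 3) * (x * legendre_deriv k (Suc n) x + real k * legendre_deriv j (Suc n) x)"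
    by (simp add: higher_pderiv_add higher_pderiv_smult legendre_deriv_def Suc algebra_simps del: funpow.simps)
  have "(pderiv ^^ j) (pderiv (legendre_poly (Suc (Suc n))))
     = (pderiv ^^ j) (pderiv (legendre_poly n) + smult (2 * real n + 3) (legendre_poly (Suc n)))"
    by (simp only: pderiv_legendre_poly_diff)
  from arg_cong[OF this, of "\<lambda>p. poly p x"]
  have 2: "legendre_deriv k (Suc (Suc n)) x = legendre_deriv k n x + (2 * real n + 3) * legendre_deriv j (Suc n) x"
    by (simp add: higher_pderiv_add higher_pderiv_smult legendre_deriv_def Suc funpow_Suc_right del: funpow.simps)
  have "real k * legendre_deriv k (Suc (Suc n)) x
      = real k * (legendre_deriv k n x + (2 * real n + 3) * legendre_deriv j (Suc n) x)"
    using 2 by simp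
  with 1 show ?thesis by (simp add: algebra_simps)
qed

text \<open>Outer induction on the order, inner induction on the degree in steps of two, following
  P'_{n+2} = P'_n + (2n + 3) P_{n+1}. The step closes because n^2 + 2n + 3 \<le> (n + 2)^2.\<close>

lemma legendre_deriv_bound:
  assumes x: "\<bar>x\<bar> \<le> 1"
  shows "\<bar>legendre_deriv k n x\<bar> \<le> real n ^ (2 * k)"
proof (induction k arbitrary: n)
  case 0
  then show ?case using legendre_poly_bound[OF x] by (simp add: legendre_deriv_def)
next
  case (Suc k)
  show ?case
  proof (induction n rule: induct_nat_012)
    case 0
    have "(pderiv ^^ Suc k) (1 :: real poly) = 0"
      by (simp add: funpow_Suc_right del: funpow.simps)
    then show ?case by (simp add: legendre_deriv_def del: funpow.simps)
  next
    case 1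
    have "(pderiv ^^ Suc k) [:0, 1 :: real:] = (if k = 0 then 1 else 0)"
      by (cases k) (simp_all add: pderiv_pCons funpow_Suc_right del: funpow.simps)
    then show ?case by (simp add: legendre_deriv_def del: funpow.simps)
  next
    case (ge2 n)
    have "(pderiv ^^ k) (pderiv (legendre_poly (Suc (Suc n))))
       = (pderiv ^^ k) (pderiv (legendre_poly n) + smult (2 * real n + 3) (legendre_poly (Suc n)))"
      by (simp only: pderiv_legendre_poly_diff)
    from arg_cong[OF this, of "\<lambda>p. poly p x"]
    have "legendre_deriv (Suc k) (Suc (Suc n)) x
        = legendre_deriv (Suc k) n x + (2 * real n + 3) * legendre_deriv k (Suc n) x"
      by (simp add: higher_pderiv_add higher_pderiv_smult legendre_deriv_def funpow_Suc_right del: funpow.simps)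
    also have "\<bar>\<dots>\<bar> \<le> \<bar>legendre_deriv (Suc k) n x\<bar> + (2 * real n + 3) * \<bar>legendre_deriv k (Suc n) x\<bar>"
      by (rule order.trans[OF abs_triangle_ineq]) (simp add: abs_mult)
    also have "\<dots> \<le> real n ^ (2 * Suc k) + (2 * real n + 3) * real (Suc n) ^ (2 * k)"
      using ge2(1) Suc.IH[of "Suc n"] by (intro add_mono mult_left_mono) auto
    also have "\<dots> = (real n)\<^sup>2 * real n ^ (2 * k) + (2 * real n + 3) * real (Suc n) ^ (2 * k)"
      by (simp add: power2_eq_square)
    also have "\<dots> \<le> (real n)\<^sup>2 * real (Suc (Suc n)) ^ (2 * k) + (2 * real n + 3) * real (Suc (Suc n)) ^ (2 * k)"
      by (intro add_mono mult_left_mono power_mono) auto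
    also have "\<dots> = ((real n)\<^sup>2 + 2 * real n + 3) * real (Suc (Suc n)) ^ (2 * k)"
      by (simp add: algebra_simps)
    also have "\<dots> \<le> (real (Suc (Suc n)))\<^sup>2 * real (Suc (Suc n)) ^ (2 * k)"
      by (intro mult_right_mono) (auto simp: power2_eq_square algebra_simps)
    finally show ?case by (simp add: power2_eq_square)
  qed
qed

section \<open>Sequences that are smooth at scale N\<close>

text \<open>A family \<open>a N n\<close> behaves like \<open>f (n / N)\<close> with a smooth \<open>f\<close> if its iterated
  rescaled differences are bounded. The window \<open>n \<ge> N / 4\<close> is closed under forward shifts and
  eventually contains all indices that matter for the wavelets.\<close>

definition window_bdd :: "(nat \<Rightarrow> nat \<Rightarrow> real) \<Rightarrow> bool" where
  "window_bdd a \<longleftrightarrow> (\<exists>C. \<forall>\<^sub>F N in sequentially. \<forall>n. N \<le> 4 * n \<longrightarrow> \<bar>a N n\<bar> \<le> C)"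

definition scaled_diff :: "(nat \<Rightarrow> nat \<Rightarrow> real) \<Rightarrow> nat \<Rightarrow> nat \<Rightarrow> real" where
  "scaled_diff a N n = real N * (a N (Suc n) - a N n)"

definition shift :: "(nat \<Rightarrow> nat \<Rightarrow> real) \<Rightarrow> nat \<Rightarrow> nat \<Rightarrow> real" where
  "shift a N n = a N (Suc n)"

fun symb :: "nat \<Rightarrow> (nat \<Rightarrow> nat \<Rightarrow> real) \<Rightarrow> bool" where
  "symb 0 a \<longleftrightarrow> window_bdd a"
| "symb (Suc m) a \<longleftrightarrow> window_bdd a \<and> symb m (scaled_diff a)"

lemma window_bdd_cong:
  assumes "\<forall>\<^sub>F N in sequentially. \<forall>n. N \<le> 4 * n \<longrightarrow> a N n = b N n" and "window_bdd a"
  shows "window_bdd b"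
proof -
  obtain C where "\<forall>\<^sub>F N in sequentially. \<forall>n. N \<le> 4 * n \<longrightarrow> \<bar>a N n\<bar> \<le> C"
    using assms(2) unfolding window_bdd_def by blast
  with assms(1) have "\<forall>\<^sub>F N in sequentially. \<forall>n. N \<le> 4 * n \<longrightarrow> \<bar>b N n\<bar> \<le> C"
    by eventually_elim auto
  then show ?thesis unfolding window_bdd_def by blast
qed

lemma window_bdd_add:
  assumes "window_bdd a" "window_bdd b"
  shows "window_bdd (\<lambda>N n. a N n + b N n)"
proof -
  obtain C D where "\<forall>\<^sub>F N in sequentially. \<forall>n. N \<le> 4 * n \<longrightarrow> \<bar>a N n\<bar> \<le> C"
    and "\<forall>\<^sub>F N in sequentially. \<forall>n. N \<le> 4 * n \<longrightarrow> \<bar>b N n\<bar> \<le> D"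
    using assms unfolding window_bdd_def by blast
  then have "\<forall>\<^sub>F N in sequentially. \<forall>n. N \<le> 4 * n \<longrightarrow> \<bar>a N n + b N n\<bar> \<le> C + D"
    by eventually_elim (meson abs_triangle_ineq add_mono order_trans)
  then show ?thesis unfolding window_bdd_def by blast
qed

lemma window_bdd_mult:
  assumes "window_bdd a" "window_bdd b"
  shows "window_bdd (\<lambda>N n. a N n * b N n)"
proof -
  obtain C D where "\<forall>\<^sub>F N in sequentially. \<forall>n. N \<le> 4 * n \<longrightarrow> \<bar>a N n\<bar> \<le> C"
    and "\<forall>\<^sub>F N in sequentially. \<forall>n. N \<le> 4 * n \<longrightarrow> \<bar>b N n\<bar> \<le> D"
    using assms unfolding window_bdd_def by blast
  then have "\<forall>\<^sub>F N in sequentially. \<forall>n. N \<le> 4 * n \<longrightarrow> \<bar>a N n * b N n\<bar> \<le> C * D"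
    by eventually_elim (simp add: abs_mult, meson abs_ge_zero mult_mono order_trans)
  then show ?thesis unfolding window_bdd_def by blast
qed

lemma window_bdd_shift:
  assumes "window_bdd a"
  shows "window_bdd (shift a)"
proof -
  obtain C where "\<forall>\<^sub>F N in sequentially. \<forall>n. N \<le> 4 * n \<longrightarrow> \<bar>a N n\<bar> \<le> C"
    using assms unfolding window_bdd_def by blast
  then have "\<forall>\<^sub>F N in sequentially. \<forall>n. N \<le> 4 * n \<longrightarrow> \<bar>shift a N n\<bar> \<le> C"
    by eventually_elim (auto simp: shift_def)
  then show ?thesis unfolding window_bdd_def by blast
qed

lemma symb_mono: "symb m a \<Longrightarrow> m' \<le> m \<Longrightarrow> symb m' a"
proof (induction m arbitrary: m' a)
  case (Suc m)
  then show ?case by (cases m') auto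
qed simp

lemma symb_cong:
  assumes "\<forall>\<^sub>F N in sequentially. \<forall>n. N \<le> 4 * n \<longrightarrow> a N n = b N n" and "symb m a"
  shows "symb m b"
  using assms
proof (induction m arbitrary: a b)
  case 0
  then show ?case using window_bdd_cong by auto
next
  case (Suc m)
  have "\<forall>\<^sub>F N in sequentially. \<forall>n. N \<le> 4 * n \<longrightarrow> scaled_diff a N n = scaled_diff b N n"
    using Suc.prems(1) by eventually_elim (auto simp: scaled_diff_def)
  with Suc.IH Suc.prems window_bdd_cong show ?case by auto
qed

lemma symb_add: "symb m a \<Longrightarrow> symb m b \<Longrightarrow> symb m (\<lambda>N n. a N n + b N n)"
proof (induction m arbitrary: a b)
  case (Suc m)
  have "scaled_diff (\<lambda>N n. a N n + b N n) = (\<lambda>N n. scaled_diff a N n + scaled_diff b N n)"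
    by (simp add: fun_eq_iff scaled_diff_def algebra_simps)
  with Suc show ?case by (auto intro: window_bdd_add)
qed (auto intro: window_bdd_add)

lemma symb_shift: "symb m a \<Longrightarrow> symb m (shift a)"
proof (induction m arbitrary: a)
  case (Suc m)
  have "scaled_diff (shift a) = shift (scaled_diff a)"
    by (simp add: fun_eq_iff scaled_diff_def shift_def)
  with Suc show ?case by (auto intro: window_bdd_shift)
qed (auto intro: window_bdd_shift)

lemma symb_const: "symb m (\<lambda>N n. c)"
proof (induction m arbitrary: c)
  case 0
  then show ?case by (auto simp: window_bdd_def intro!: exI[of _ "\<bar>c\<bar>"])
next
  case (Suc m)
  have "window_bdd (\<lambda>N n. c)" by (auto simp: window_bdd_def intro!: exI[of _ "\<bar>c\<bar>"])
  moreover have "scaled_diff (\<lambda>N n. c) = (\<lambda>N n. 0)" by (simp add: fun_eq_iff scaled_diff_def)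
  ultimately show ?case using Suc by simp
qed

text \<open>Discrete product rule: the difference of a product is (difference of \<open>a\<close>)
  times (shifted \<open>b\<close>) plus \<open>a\<close> times (difference of \<open>b\<close>).
  This is why stability under \<open>shift\<close> is needed.\<close>

lemma symb_mult: "symb m a \<Longrightarrow> symb m b \<Longrightarrow> symb m (\<lambda>N n. a N n * b N n)"
proof (induction m arbitrary: a b)
  case (Suc m)
  have "scaled_diff (\<lambda>N n. a N n * b N n)
      = (\<lambda>N n. scaled_diff a N n * shift b N n + a N n * scaled_diff b N n)"
    by (simp add: fun_eq_iff scaled_diff_def shift_def algebra_simps)
  moreover have "symb m a" "symb m (shift b)"
    using Suc.prems symb_mono[of "Suc m"] symb_shift by (blast intro: le_SucI)+
  ultimately show ?case
    using Suc by (auto intro: window_bdd_mult symb_add)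
qed (auto intro: window_bdd_mult)

section \<open>Sampled smooth functions and reciprocal powers\<close>

text \<open>\<open>D N i\<close> is the \<open>i\<close>-th derivative of the sampled function. It
  may depend on \<open>N\<close> because the induction replaces it by its rescaled difference
  quotient with step 1/N, which is again such a family.\<close>

lemma symb_of_derivatives:
  fixes D :: "nat \<Rightarrow> nat \<Rightarrow> real \<Rightarrow> real"
  assumes "N0 \<ge> 1"
    and "\<And>N i t. N \<ge> N0 \<Longrightarrow> i < m \<Longrightarrow> t \<ge> 1/4 \<Longrightarrow> (D N i has_real_derivative D N (Suc i) t) (at t)"
    and "\<And>N i t. N \<ge> N0 \<Longrightarrow> i \<le> m \<Longrightarrow> t \<ge> 1/4 \<Longrightarrow> \<bar>D N i t\<bar> \<le> C"
  shows "symb m (\<lambda>N n. D N 0 (real n / real N))"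
  using assms(2,3)
proof (induction m arbitrary: D)
  case (0 D)
  have "\<forall>\<^sub>F N in sequentially. \<forall>n. N \<le> 4 * n \<longrightarrow> \<bar>D N 0 (real n / real N)\<bar> \<le> C"
    using eventually_ge_at_top[of N0]
    by eventually_elim (use 0 assms(1) in \<open>auto simp: field_simps\<close>)
  then show ?case by (auto simp: window_bdd_def)
next
  case (Suc m D)
  have "\<forall>\<^sub>F N in sequentially. \<forall>n. N \<le> 4 * n \<longrightarrow> \<bar>D N 0 (real n / real N)\<bar> \<le> C"
    using eventually_ge_at_top[of N0]
    by eventually_elim (use Suc assms(1) in \<open>auto simp: field_simps\<close>)
  then have "window_bdd (\<lambda>N n. D N 0 (real n / real N))" by (auto simp: window_bdd_def)
  moreover have "symb m (\<lambda>N n. real N * (D N 0 (real n / real N + 1 / real N) - D N 0 (real n / real N)))"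
  proof (rule Suc.IH)
    fix N i and t :: real
    assume *: "N0 \<le> N" "i < m" "1 / 4 \<le> t"
    have "1 / 4 \<le> t + 1 / real N" using * by (simp add: add_increasing2)
    with * show "((\<lambda>t. real N * (D N i (t + 1 / real N) - D N i t)) has_real_derivative
        real N * (D N (Suc i) (t + 1 / real N) - D N (Suc i) t)) (at t)"
      by (intro DERIV_cmult DERIV_diff Suc.prems(1))
        (use Suc.prems(1)[of N i "t + 1 / real N"] in \<open>auto simp: DERIV_shift\<close>)
  next
    fix N i and t :: real
    assume *: "N0 \<le> N" "i \<le> m" "1 / 4 \<le> t"
    have N: "real N > 0" using * assms(1) by simp
    \<comment> \<open>The mean value theorem bounds the rescaled difference by one more derivative,
      so the same constant \<open>C\<close> serves the new family.\<close>
    have "\<exists>z. t < z \<and> z < t + 1 / real N \<and>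
        D N i (t + 1 / real N) - D N i t = (t + 1 / real N - t) * D N (Suc i) z"
      using * N by (intro MVT2 Suc.prems(1)) auto
    then obtain z where "t < z" and
      "D N i (t + 1 / real N) - D N i t = 1 / real N * D N (Suc i) z" by auto
    moreover have "\<bar>D N (Suc i) z\<bar> \<le> C" using * \<open>t < z\<close> by (intro Suc.prems(2)) auto
    ultimately show "\<bar>real N * (D N i (t + 1 / real N) - D N i t)\<bar> \<le> C"
      using N by simp
  qed
  then have "symb m (scaled_diff (\<lambda>N n. D N 0 (real n / real N)))"
    by (simp add: scaled_diff_def[abs_def] add_divide_distrib add.commute)
  ultimately show ?case by simp
qed

lemma symb_reciprocal_powr:
  assumes "s > 0"
  shows "symb m (\<lambda>N n. (real N / (real n + c)) powr s)"
proof -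
  \<comment> \<open>With t = n/N the sequence is (t + c/N) to the power -s; \<open>A i\<close> is
    the factor produced by differentiating it \<open>i\<close> times.\<close>
  define A where "A i = (\<Prod>l<i. - s - real l)" for i
  define D where "D N i t = A i * (t + c / real N) powr (- s - real i)" for N i t
  \<comment> \<open>Large enough that |c|/N \<le> 1/8, which keeps t + c/N \<ge> 1/8 on the window t
    \<ge> 1/4, away from the singularity.\<close>
  define N0 where "N0 = Suc (nat \<lceil>8 * \<bar>c\<bar>\<rceil>)"
  have N0: "8 * \<bar>c\<bar> \<le> real N" "real N > 0" if "N \<ge> N0" for N
    using that unfolding N0_def by linarith+
  have ge: "t + c / real N \<ge> 1/8" if "N \<ge> N0" "t \<ge> 1/4" for N and t :: real
  proof -
    have "\<bar>c / real N\<bar> \<le> 1 / 8" using N0[OF that(1)] by (simp add: divide_simps)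
    with that show ?thesis by linarith
  qed
  define C where "C = (\<Sum>i\<le>m. \<bar>A i\<bar> * (1/8) powr (- s - real i))"
  have "symb m (\<lambda>N n. D N 0 (real n / real N))"
  proof (rule symb_of_derivatives[of N0 m D C])
    fix N i and t :: real
    assume *: "N0 \<le> N" "i < m" "1 / 4 \<le> t"
    have "t + c / real N > 0" using ge[OF *(1,3)] by linarith
    then have "((\<lambda>t. (t + c / real N) powr (- s - real i)) has_real_derivative
        (- s - real i) * (t + c / real N) powr (- s - real i - 1)) (at t)"
      by (auto intro!: derivative_eq_intros has_real_derivative_powr)
    from DERIV_cmult[OF this, of "A i"]
    show "(D N i has_real_derivative D N (Suc i) t) (at t)"
      by (simp add: D_def[abs_def] A_def mult_ac diff_diff_eq add_ac)
  next
    fix N i and t :: real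
    assume *: "N0 \<le> N" "i \<le> m" "1 / 4 \<le> t"
    have "\<bar>D N i t\<bar> \<le> \<bar>A i\<bar> * (1/8) powr (- s - real i)"
      using ge[OF *(1,3)] assms by (auto simp: D_def abs_mult intro!: mult_left_mono powr_mono2')
    also have "\<dots> \<le> C"
      unfolding C_def by (rule member_le_sum[of i "{..m}"]) (use * in auto)
    finally show "\<bar>D N i t\<bar> \<le> C" .
  qed (simp add: N0_def)
  moreover have "\<forall>\<^sub>F N in sequentially. \<forall>n. N \<le> 4 * n \<longrightarrow>
      D N 0 (real n / real N) = (real N / (real n + c)) powr s"
    using eventually_ge_at_top[of N0]
  proof eventually_elim
    case (elim N)
    have "D N 0 (real n / real N) = (real N / (real n + c)) powr s" if "N \<le> 4 * n" for n
    proof -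
      have "real n / real N + c / real N \<ge> 1 / 8"
        using elim that N0[OF elim] by (intro ge) (auto simp: divide_simps)
      then have "real n / real N + c / real N > 0" by linarith
      then have "(real n + c) / real N > 0" by (simp only: add_divide_distrib)
      then have "((real n + c) / real N) powr (- s) = (inverse ((real n + c) / real N)) powr s"
        using inverse_powr powr_minus by (metis)
      moreover have "inverse ((real n + c) / real N) = real N / (real n + c)" by simp
      moreover have "D N 0 (real n / real N) = ((real n + c) / real N) powr (- s)"
        by (simp add: D_def A_def add_divide_distrib)
      ultimately show ?thesis by (simp only:)
    qed
    then show ?case by blast
  qed
  ultimately show ?thesis by (rule symb_cong[rotated])
qed

section \<open>Summation by parts and decay of Legendre sums\<close>

text \<open>Multiplying \<open>\<Sum>n. (2 n + 2 j + 1) a n P\<^bsub>n+j\<^esub>\<^bsup>(k)\<^esup>(x)\<close> by \<open>1 - x\<close> and applying the three-term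
  recurrence replaces \<open>a\<close> by a second-order difference of \<open>a\<close>. To avoid subtraction in \<open>nat\<close>, the
  new sequence is shifted by one index, and \<open>j\<close> records the accumulated shift.\<close>

definition legendre_diff :: "nat \<Rightarrow> nat \<Rightarrow> (nat \<Rightarrow> real) \<Rightarrow> nat \<Rightarrow> real" where
  "legendre_diff k j a n = a (Suc n)
     - ((real (n + j) + 1 - real k) * a n + (real (n + j) + 2 + real k) * a (Suc (Suc n)))
       / (2 * real (n + j) + 3)"

fun legendre_diffs :: "nat \<Rightarrow> nat \<Rightarrow> (nat \<Rightarrow> real) \<Rightarrow> nat \<Rightarrow> real" where
  "legendre_diffs k 0 a = a"
| "legendre_diffs k (Suc j) a = legendre_diff k j (legendre_diffs k j a)"

text \<open>By the recurrence, corresponding terms of the two sums, with indices offset by one,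
  differ by an increment of \<open>G\<close>. The telescoped boundary values are zero since
  \<open>a\<close> vanishes at 0 and 1 and from \<open>B\<close> on.\<close>

lemma legendre_sum_by_parts:
  assumes "a 0 = 0" "a (Suc 0) = 0" "\<And>n. n \<ge> B \<Longrightarrow> a n = 0"
  shows "(1 - x) * (\<Sum>n<B. (2 * real (n + j) + 1) * a n * legendre_deriv k (n + j) x)
    = (\<Sum>n<B. (2 * real (n + j) + 3) * legendre_diff k j a n * legendre_deriv k (Suc (n + j)) x)"
proof -
  let ?Q = "\<lambda>n. legendre_deriv k n x"
  define G where "G n = (real (n + j) + 1 - real k) * a n * ?Q (Suc (n + j))
      - (real (n + j) + 1 + real k) * a (Suc n) * ?Q (n + j)" for n
  have "(2 * real (n + j) + 3) * legendre_diff k j a n * ?Q (Suc (n + j))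
      = (1 - x) * ((2 * real (n + j) + 3) * a (Suc n) * ?Q (Suc (n + j))) + (G (Suc n) - G n)" for n
  proof -
    define w where "w = 2 * real (n + j) + 3"
    have "w \<noteq> 0" unfolding w_def by linarith
    then have "w * legendre_diff k j a n
      = w * a (Suc n) - ((real (n + j) + 1 - real k) * a n + (real (n + j) + 2 + real k) * a (Suc (Suc n)))"
      unfolding legendre_diff_def w_def[symmetric] by (simp add: right_diff_distrib)
    then have e1: "w * legendre_diff k j a n * ?Q (Suc (n + j)) = w * a (Suc n) * ?Q (Suc (n + j))
       - ((real (n + j) + 1 - real k) * a n + (real (n + j) + 2 + real k) * a (Suc (Suc n))) * ?Q (Suc (n + j))"
      by (simp only: left_diff_distrib)
    have e2: "(1 - x) * (w * a (Suc n) * ?Q (Suc (n + j)))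
        = w * a (Suc n) * ?Q (Suc (n + j)) - a (Suc n) * (w * x * ?Q (Suc (n + j)))"
      by (simp add: algebra_simps)
    have e3: "w * x * ?Q (Suc (n + j)) = (real (n + j) + 2 - real k) * ?Q (Suc (Suc (n + j)))
        + (real (n + j) + 1 + real k) * ?Q (n + j)"
      unfolding w_def by (rule legendre_deriv_recurrence)
    show ?thesis
      unfolding w_def[symmetric] e1 e2 e3 G_def by (simp add: algebra_simps)
  qed
  then have "(\<Sum>n<B. (2 * real (n + j) + 3) * legendre_diff k j a n * ?Q (Suc (n + j)))
      = (1 - x) * (\<Sum>n<B. (2 * real (n + j) + 3) * a (Suc n) * ?Q (Suc (n + j)))
        + (\<Sum>n<B. G (Suc n) - G n)"
    by (simp add: sum.distrib sum_distrib_left)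
  also have "(\<Sum>n<B. G (Suc n) - G n) = 0"
    using assms(1,2) assms(3)[of B] assms(3)[of "Suc B"] by (simp only: sum_lessThan_telescope) (simp add: G_def)
  \<comment> \<open>Reindexing by one adds only the term for 0, where \<open>a\<close> vanishes; the
    surplus top term vanishes because of \<open>a B = 0\<close>.\<close>
  also have "(\<Sum>n<B. (2 * real (n + j) + 3) * a (Suc n) * ?Q (Suc (n + j)))
      = (\<Sum>n<Suc B. (2 * real (n + j) + 1) * a n * ?Q (n + j))"
    unfolding sum.lessThan_Suc_shift using assms(1) by (simp add: algebra_simps)
  finally show ?thesis using assms(3)[of B] by simp
qed

text \<open>Each difference at \<open>n\<close> reads the entries \<open>n\<close>,
  \<open>n + 1\<close> and \<open>n + 2\<close>, so the lower end of the support drops by two per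
  step and the upper bound persists.\<close>

lemma legendre_diffs_eq_0:
  assumes "\<And>n. n < L \<Longrightarrow> a n = 0" "\<And>n. n \<ge> B \<Longrightarrow> a n = 0" and "n + 2 * j < L \<or> B \<le> n"
  shows "legendre_diffs k j a n = 0"
  using assms(3)
proof (induction j arbitrary: n)
  case (Suc j)
  then show ?case by (auto simp: legendre_diff_def)
qed (use assms in auto)

lemma legendre_sum_by_parts_iterated:
  assumes "\<And>n. n < 2 * M \<Longrightarrow> a n = 0" "\<And>n. n \<ge> B \<Longrightarrow> a n = 0"
  shows "(1 - x) ^ M * (\<Sum>n<B. (2 * real n + 1) * a n * legendre_deriv k n x)
    = (\<Sum>n<B. (2 * real (n + M) + 1) * legendre_diffs k M a n * legendre_deriv k (n + M) x)"
proof -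
  \<comment> \<open>The restriction \<open>j \<le> M\<close> ensures that before each further step
    the entries 0 and 1 are still zero, as summation by parts requires.\<close>
  have "(1 - x) ^ j * (\<Sum>n<B. (2 * real n + 1) * a n * legendre_deriv k n x)
    = (\<Sum>n<B. (2 * real (n + j) + 1) * legendre_diffs k j a n * legendre_deriv k (n + j) x)"
    if "j \<le> M" for j
    using that
  proof (induction j)
    case (Suc j)
    have "(1 - x) ^ Suc j * (\<Sum>n<B. (2 * real n + 1) * a n * legendre_deriv k n x)
      = (1 - x) * (\<Sum>n<B. (2 * real (n + j) + 1) * legendre_diffs k j a n * legendre_deriv k (n + j) x)"
      using Suc by simp
    also have "\<dots> = (\<Sum>n<B. (2 * real (n + j) + 3) * legendre_diff k j (legendre_diffs k j a) n
        * legendre_deriv k (Suc (n + j)) x)"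
      using Suc.prems
      by (intro legendre_sum_by_parts legendre_diffs_eq_0[where L = "2 * M" and B = B] assms) auto
    finally show ?case by (simp add: algebra_simps)
  qed simp
  then show ?thesis by blast
qed

text \<open>The two outer weights in \<open>legendre_diff\<close> differ from 1/2 by (2k + 1)/(2w)
  with opposite signs, where w = 2(n + j) + 3. Hence \<open>legendre_diff\<close> is -1/2 times a
  second difference plus a first-order difference with coefficient of order 1/N. Each step thus
  gains N^2 at the cost of two orders of smoothness.\<close>

lemma symb_legendre_diffs:
  "symb (m + 2 * j) a \<Longrightarrow> symb m (\<lambda>N n. real N ^ (2 * j) * legendre_diffs k j (a N) n)"
proof (induction j arbitrary: m)
  case (Suc j)
  define b where "b N n = real N ^ (2 * j) * legendre_diffs k j (a N) n" for N n
  have b: "symb (Suc (Suc m)) b"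
    using Suc.IH[of "Suc (Suc m)"] Suc.prems by (simp add: b_def[abs_def])
  define d where "d = scaled_diff b"
  have d: "symb m d" "symb m (scaled_diff d)"
    using b symb_mono[of "Suc m" d m] by (auto simp: d_def)
  \<comment> \<open>This is 2N/w, the bounded rescaling of the small coefficient of the first-order
    term.\<close>
  define g where "g N n = real N / (real n + (real j + 3/2))" for N n
  have g: "symb m g"
    using symb_reciprocal_powr[of 1 m "real j + 3/2"] by (simp add: g_def[abs_def])
  have "symb m (\<lambda>N n. (- 1 / 2) * scaled_diff d N n
      + ((- (2 * real k + 1) / 4) * g N n) * (d N n + shift d N n))"
    by (intro symb_add symb_mult symb_const d g symb_shift)
  moreover have "(- 1 / 2) * scaled_diff d N n
      + ((- (2 * real k + 1) / 4) * g N n) * (d N n + shift d N n)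
      = real N ^ (2 * Suc j) * legendre_diffs k (Suc j) (a N) n" for N n
  proof -
    define w where "w = 2 * real (n + j) + 3"
    have w: "w > 0" by (simp add: w_def)
    have u: "real (n + j) + 1 - real k = (w - 1 - 2 * real k) / 2"
      "real (n + j) + 2 + real k = (w + 1 + 2 * real k) / 2"
      by (simp_all add: w_def field_simps)
    have g': "g N n = 2 * real N / w"
      by (simp add: g_def w_def field_simps)
    have "real N ^ (2 * Suc j) * legendre_diffs k (Suc j) (a N) n
        = (real N)\<^sup>2 * (b N (Suc n) - ((w - 1 - 2 * real k) / 2 * b N n + (w + 1 + 2 * real k) / 2 * b N (Suc (Suc n))) / w)"
      unfolding b_def legendre_diffs.simps legendre_diff_def u w_def[symmetric]
      by (simp add: power2_eq_square algebra_simps add_divide_distrib)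
    also have "\<dots> = (- 1 / 2) * scaled_diff d N n
      + ((- (2 * real k + 1) / 4) * g N n) * (d N n + shift d N n)"
    proof -
      have *: "((w - 1 - 2 * real k) / 2 * b N n + (w + 1 + 2 * real k) / 2 * b N (Suc (Suc n))) / w
        = (b N n + b N (Suc (Suc n))) / 2 + (2 * real k + 1) / 2 * (1 / w) * (b N (Suc (Suc n)) - b N n)"
        using w by (simp add: field_simps)
      have **: "g N n = 2 * real N * (1 / w)" by (simp add: g')
      show ?thesis
        unfolding * ** d_def scaled_diff_def shift_def by (simp only: power2_eq_square) algebra
    qed
    finally show ?thesis by simp
  qed
  ultimately show ?case by (simp only:)
qed simp

text \<open>After \<open>M\<close> summations by parts and multiplication by N^(2M) there are 2N + 1
  terms, each with a weight of order N, a bounded scaled difference and a Legendre derivative of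
  order N^(2k).\<close>

lemma legendre_sum_bound:
  assumes "symb (2 * M) a" and supp: "\<And>N n. 2 * n < N \<or> 2 * N < n \<Longrightarrow> a N n = 0"
  obtains C where "C \<ge> 0" "\<forall>\<^sub>F N in sequentially. \<forall>x. \<bar>x\<bar> \<le> 1 \<longrightarrow>
    ((real N)\<^sup>2 * (1 - x)) ^ M * \<bar>\<Sum>n\<le>2 * N. (2 * real n + 1) * a N n * legendre_deriv k n x\<bar>
      \<le> C * real N ^ (2 + 2 * k)"
proof -
  have "symb 0 (\<lambda>N n. real N ^ (2 * M) * legendre_diffs k M (a N) n)"
    using symb_legendre_diffs[of 0 M a k] assms(1) by simp
  then obtain C where C: "\<forall>\<^sub>F N in sequentially. \<forall>n. N \<le> 4 * n \<longrightarrow>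
      \<bar>real N ^ (2 * M) * legendre_diffs k M (a N) n\<bar> \<le> C"
    by (auto simp: window_bdd_def)
  define C' where "C' = 3 * (7 * \<bar>C\<bar> * 3 ^ (2 * k))"
  have "\<forall>\<^sub>F N in sequentially. \<forall>x. \<bar>x\<bar> \<le> 1 \<longrightarrow>
    ((real N)\<^sup>2 * (1 - x)) ^ M * \<bar>\<Sum>n\<le>2 * N. (2 * real n + 1) * a N n * legendre_deriv k n x\<bar>
      \<le> C' * real N ^ (2 + 2 * k)"
    \<comment> \<open>This size of \<open>N\<close> keeps the support, lowered by 2M, inside the
      window \<open>N \<le> 4 * n\<close>, and the shifted degrees \<open>n + M\<close> below
      3N.\<close>
    using C eventually_ge_at_top[of "8 * M + 1"]
  proof eventually_elim
    case (elim N)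
    show ?case
    proof (intro allI impI)
      fix x :: real assume x: "\<bar>x\<bar> \<le> 1"
      let ?L = "legendre_diffs k M (a N)"
      have a0: "a N n = 0" if "n < (N + 1) div 2" for n using that by (intro supp) linarith
      have a1: "a N n = 0" if "n \<ge> 2 * N + 1" for n using that by (intro supp) linarith
      have term_le: "\<bar>real N ^ (2 * M) * ((2 * real (n + M) + 1) * ?L n * legendre_deriv k (n + M) x)\<bar>
          \<le> 7 * \<bar>C\<bar> * 3 ^ (2 * k) * real N ^ (1 + 2 * k)" if n: "n < 2 * N + 1" for n
      proof (cases "N \<le> 4 * n")
        case True
        have nM: "real (n + M) \<le> 3 * real N" "2 * real (n + M) + 1 \<le> 7 * real N"
        proof -
          have "n + M \<le> 3 * N" "2 * (n + M) + 1 \<le> 7 * N" using n elim(2) by presburger+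
          then show "real (n + M) \<le> 3 * real N" "2 * real (n + M) + 1 \<le> 7 * real N" by linarith+
        qed
        have "\<bar>legendre_deriv k (n + M) x\<bar> \<le> (3 * real N) ^ (2 * k)"
          using legendre_deriv_bound[OF x, of k "n + M"] power_mono[OF nM(1), of "2 * k"] by simp
        moreover have "\<bar>real N ^ (2 * M) * ?L n\<bar> \<le> \<bar>C\<bar>"
          using elim(1) True by (meson abs_ge_self order_trans)
        ultimately have "(2 * real (n + M) + 1) * \<bar>real N ^ (2 * M) * ?L n\<bar> * \<bar>legendre_deriv k (n + M) x\<bar>
            \<le> (7 * real N) * \<bar>C\<bar> * (3 * real N) ^ (2 * k)"
          using nM(2) by (intro mult_mono) auto
        then show ?thesis by (simp add: abs_mult power_mult_distrib mult_ac)
      next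
        case False
        then have "n + 2 * M < (N + 1) div 2" using elim(2) by linarith
        then have "?L n = 0"
          using legendre_diffs_eq_0[of "(N + 1) div 2" "a N" "2 * N + 1" n M k] a0 a1 by blast
        then show ?thesis by simp
      qed
      have "((real N)\<^sup>2 * (1 - x)) ^ M * \<bar>\<Sum>n\<le>2 * N. (2 * real n + 1) * a N n * legendre_deriv k n x\<bar>
        = \<bar>real N ^ (2 * M) * ((1 - x) ^ M * (\<Sum>n<2 * N + 1. (2 * real n + 1) * a N n * legendre_deriv k n x))\<bar>"
        using x by (simp add: abs_mult power_mult_distrib power_mult lessThan_Suc_atMost)
      also have "\<dots> = \<bar>\<Sum>n<2 * N + 1. real N ^ (2 * M) * ((2 * real (n + M) + 1) * ?L n * legendre_deriv k (n + M) x)\<bar>"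
      proof -
        have "a N n = 0" if "n < 2 * M" for n using that elim(2) by (intro a0) linarith
        from legendre_sum_by_parts_iterated[OF this a1, where x = x and k = k] show ?thesis
          by (simp only: sum_distrib_left)
      qed
      also have "\<dots> \<le> (\<Sum>n<2 * N + 1. 7 * \<bar>C\<bar> * 3 ^ (2 * k) * real N ^ (1 + 2 * k))"
        using term_le by (intro order.trans[OF sum_abs] sum_mono) auto
      also have "\<dots> = (2 * real N + 1) * (7 * \<bar>C\<bar> * 3 ^ (2 * k) * real N ^ (1 + 2 * k))"
        by simp
      also have "\<dots> \<le> (3 * real N) * (7 * \<bar>C\<bar> * 3 ^ (2 * k) * real N ^ (1 + 2 * k))"
        using elim(2) by (intro mult_right_mono) auto
      finally show "((real N)\<^sup>2 * (1 - x)) ^ M * \<bar>\<Sum>n\<le>2 * N. (2 * real n + 1) * a N n * legendre_deriv k n x\<bar>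
        \<le> C' * real N ^ (2 + 2 * k)"
        by (simp add: C'_def mult_ac)
    qed
  qed
  then show ?thesis by (rule that[rotated]) (simp add: C'_def)
qed

text \<open>Concavity of the sine on [0, pi/2] puts sin(\<theta>/2) above its chord \<theta>/pi;
  then square and use the half-angle formula.\<close>

lemma square_le_one_minus_cos:
  assumes "0 \<le> \<theta>" "\<theta> \<le> pi"
  shows "\<theta>\<^sup>2 \<le> pi\<^sup>2 / 2 * (1 - cos \<theta>)"
proof -
  have "concave_on {0..pi/2} sin"
    by (rule f''_le0_imp_concave[where f' = cos and f'' = "\<lambda>x. - sin x"])
      (auto intro!: derivative_eq_intros sin_ge_zero)
  from concave_onD[OF this, of "\<theta> / pi" 0 "pi / 2"] assms
  have "\<theta> / pi \<le> sin (\<theta> / 2)" by (simp add: divide_simps)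
  then have "(\<theta> / pi)\<^sup>2 \<le> (sin (\<theta> / 2))\<^sup>2"
    using assms by (intro power_mono) auto
  also have "\<dots> = (1 - cos \<theta>) / 2"
    using cos_double_sin[of "\<theta> / 2"] by simp
  finally show ?thesis by (simp add: power_divide divide_simps mult_ac)
qed

text \<open>Uses (1 + N\<theta>)^q \<le> 2^q (1 + (N\<theta>)^(2M)) and replaces (N\<theta>)^2 by a
  multiple of N^2 (1 - cos \<theta>).\<close>

lemma legendre_kernel_decay:
  assumes "symb (2 * M) a" and supp: "\<And>N n. 2 * n < N \<or> 2 * N < n \<Longrightarrow> a N n = 0" and "q \<le> 2 * M"
  obtains C where "C \<ge> 0" "\<forall>\<^sub>F N in sequentially. \<forall>\<theta>\<in>{0..pi}.
    (1 + real N * \<theta>) ^ q * \<bar>\<Sum>n\<le>2 * N. (2 * real n + 1) * a N n * legendre_deriv k n (cos \<theta>)\<bar>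
      \<le> C * real N ^ (2 + 2 * k)"
proof -
  obtain C where C: "C \<ge> 0" "\<forall>\<^sub>F N in sequentially. \<forall>x. \<bar>x\<bar> \<le> 1 \<longrightarrow>
    ((real N)\<^sup>2 * (1 - x)) ^ M * \<bar>\<Sum>n\<le>2 * N. (2 * real n + 1) * a N n * legendre_deriv k n x\<bar>
      \<le> C * real N ^ (2 + 2 * k)"
    by (rule legendre_sum_bound[OF assms(1) supp])
  \<comment> \<open>The case without summation by parts bounds the contribution of the summand 1,
    which is what matters near \<theta> = 0.\<close>
  have a0: "symb (2 * 0) a" using symb_mono[OF assms(1), of 0] by simp
  obtain D where D: "D \<ge> 0" "\<forall>\<^sub>F N in sequentially. \<forall>x. \<bar>x\<bar> \<le> 1 \<longrightarrow>
    ((real N)\<^sup>2 * (1 - x)) ^ 0 * \<bar>\<Sum>n\<le>2 * N. (2 * real n + 1) * a N n * legendre_deriv k n x\<bar>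
      \<le> D * real N ^ (2 + 2 * k)"
    by (rule legendre_sum_bound[OF a0 supp])
  define E where "E = 2 ^ q * (D + (pi\<^sup>2 / 2) ^ M * C)"
  have "\<forall>\<^sub>F N in sequentially. \<forall>\<theta>\<in>{0..pi}.
    (1 + real N * \<theta>) ^ q * \<bar>\<Sum>n\<le>2 * N. (2 * real n + 1) * a N n * legendre_deriv k n (cos \<theta>)\<bar>
      \<le> E * real N ^ (2 + 2 * k)"
    using C(2) D(2)
  proof eventually_elim
    case (elim N)
    show ?case
    proof
      fix \<theta> assume \<theta>: "\<theta> \<in> {0..pi}"
      define S where "S = \<bar>\<Sum>n\<le>2 * N. (2 * real n + 1) * a N n * legendre_deriv k n (cos \<theta>)\<bar>"
      have S: "S \<ge> 0" "S \<le> D * real N ^ (2 + 2 * k)"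
        "((real N)\<^sup>2 * (1 - cos \<theta>)) ^ M * S \<le> C * real N ^ (2 + 2 * k)"
        using elim by (auto simp: S_def)
      have "(1 + real N * \<theta>) ^ q \<le> 2 ^ q * (1 + (real N * \<theta>) ^ (2 * M))"
      proof (cases "real N * \<theta> \<le> 1")
        case True
        then have "(1 + real N * \<theta>) ^ q \<le> 2 ^ q * 1"
          using \<theta> by (simp add: power_mono)
        also have "\<dots> \<le> 2 ^ q * (1 + (real N * \<theta>) ^ (2 * M))"
          using \<theta> by (intro mult_left_mono) auto
        finally show ?thesis .
      next
        case False
        then have ge1: "1 \<le> real N * \<theta>" by linarith
        then have "(1 + real N * \<theta>) ^ q \<le> (2 * (real N * \<theta>)) ^ q"
          by (intro power_mono) linarith+
        also have "\<dots> = 2 ^ q * (real N * \<theta>) ^ q" by (simp add: power_mult_distrib)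
        also have "\<dots> \<le> 2 ^ q * (1 + (real N * \<theta>) ^ (2 * M))"
          using power_increasing[OF assms(3) ge1] by (intro mult_left_mono) (linarith, simp)
        finally show ?thesis .
      qed
      also have "(real N * \<theta>) ^ (2 * M) \<le> (pi\<^sup>2 / 2) ^ M * ((real N)\<^sup>2 * (1 - cos \<theta>)) ^ M"
      proof -
        have "(real N)\<^sup>2 * \<theta>\<^sup>2 \<le> (real N)\<^sup>2 * (pi\<^sup>2 / 2 * (1 - cos \<theta>))"
          using \<theta> square_le_one_minus_cos by (intro mult_left_mono) auto
        then have "((real N * \<theta>)\<^sup>2) ^ M \<le> (pi\<^sup>2 / 2 * ((real N)\<^sup>2 * (1 - cos \<theta>))) ^ M"
          by (intro power_mono) (auto simp: power_mult_distrib mult_ac)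
        then show ?thesis by (simp only: power_mult power_mult_distrib[of "pi\<^sup>2 / 2"])
      qed
      finally have "(1 + real N * \<theta>) ^ q * S
          \<le> 2 ^ q * (1 + (pi\<^sup>2 / 2) ^ M * ((real N)\<^sup>2 * (1 - cos \<theta>)) ^ M) * S"
        using S(1) by (intro mult_right_mono) auto
      also have "\<dots> = 2 ^ q * (S + (pi\<^sup>2 / 2) ^ M * (((real N)\<^sup>2 * (1 - cos \<theta>)) ^ M * S))"
        by (simp add: algebra_simps)
      also have "\<dots> \<le> 2 ^ q * (D * real N ^ (2 + 2 * k) + (pi\<^sup>2 / 2) ^ M * (C * real N ^ (2 + 2 * k)))"
        using S by (intro mult_left_mono add_mono) auto
      finally show "(1 + real N * \<theta>) ^ q * S \<le> E * real N ^ (2 + 2 * k)"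
        by (simp add: E_def algebra_simps)
    qed
  qed
  then show ?thesis by (rule that[rotated]) (use C(1) D(1) in \<open>simp add: E_def\<close>)
qed

section \<open>Wavelets as Legendre sums\<close>

text \<open>Points t \<ge> 1/4 are interior to the half-line, so the one-sided derivatives there are
  ordinary ones. They are bounded by compactness on [0, 2] and vanish beyond 2.\<close>

lemma symb_window_function:
  assumes "Cm_on m {0..} \<kappa>" and zero: "\<forall>t\<ge>0. t \<notin> {1/2..2} \<longrightarrow> \<kappa> t = 0"
  shows "symb m (\<lambda>N n. \<kappa> (real n / real N))"
proof -
  obtain D :: "nat \<Rightarrow> real \<Rightarrow> real" where D0: "D 0 = \<kappa>"
    and "\<forall>j<m. \<forall>x\<in>{0..}. (D j has_real_derivative D (Suc j) x) (at x within {0..})"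
    and Dm: "continuous_on {0..} (D m)"
    using assms(1) unfolding Cm_on_def by blast
  then have D: "(D j has_real_derivative D (Suc j) x) (at x within {0..})" if "j < m" "x \<ge> 0" for j x
    using that by simp
  have D': "(D j has_real_derivative D (Suc j) x) (at x)" if "j < m" "x > 0" for j x
    using D[of j x] that by (simp add: at_within_interior[of x "{0..}"])
  have cont: "continuous_on {0..} (D j)" if "j \<le> m" for j
  proof (cases "j = m")
    case False
    with that D[of j] show ?thesis
      by (intro DERIV_continuous_on[where D = "D (Suc j)"]) auto
  qed (use Dm in simp)
  have vanish: "D j x = 0" if "j \<le> m" "x > 2" for j x
    using that
  proof (induction j arbitrary: x)
    case 0
    then show ?case using zero by (simp add: D0)
  next
    case (Suc j)
    have "((\<lambda>x. 0) has_real_derivative D (Suc j) x) (at x)"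
    proof (rule has_field_derivative_transform_within_open)
      show "(D j has_real_derivative D (Suc j) x) (at x)" using D' Suc.prems by simp
      show "open {2::real<..}" by simp
    qed (use Suc in auto)
    from DERIV_unique[OF this DERIV_const] show ?case .
  qed
  have "\<forall>j\<in>{..m}. \<exists>C. \<forall>x\<in>{0..}. \<bar>D j x\<bar> \<le> C"
  proof
    fix j assume "j \<in> {..m}"
    then have j: "j \<le> m" by simp
    have "compact (D j ` {0..2})"
      using cont[OF j] by (intro compact_continuous_image) (auto elim: continuous_on_subset)
    then obtain C where C: "\<forall>y\<in>D j ` {0..2}. norm y \<le> C"
      using compact_imp_bounded bounded_iff by blast
    have "\<bar>D j x\<bar> \<le> max C 0" if "x \<ge> 0" for x
    proof (cases "x \<le> 2")
      case True
      with that have "norm (D j x) \<le> C" using C by simp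
      then show ?thesis by simp
    next
      case False
      then show ?thesis using vanish[OF j, of x] by simp
    qed
    then show "\<exists>C. \<forall>x\<in>{0..}. \<bar>D j x\<bar> \<le> C" by auto
  qed
  from bchoice[OF this] obtain C where C: "\<forall>j\<in>{..m}. \<forall>x\<in>{0..}. \<bar>D j x\<bar> \<le> C j" ..
  have "symb m (\<lambda>N n. D 0 (real n / real N))"
  proof (rule symb_of_derivatives[where D = "\<lambda>N. D" and ?N0.0 = 1 and C = "\<Sum>j\<le>m. \<bar>C j\<bar>"])
    fix N i and t :: real
    assume *: "i \<le> m" "1 / 4 \<le> t"
    have "\<bar>D i t\<bar> \<le> C i" using C * by simp
    then have "\<bar>D i t\<bar> \<le> \<bar>C i\<bar>" by linarith
    also have "\<dots> \<le> (\<Sum>j\<le>m. \<bar>C j\<bar>)" by (rule member_le_sum[of i "{..m}"]) (use * in auto)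
    finally show "\<bar>D i t\<bar> \<le> (\<Sum>j\<le>m. \<bar>C j\<bar>)" .
  qed (use D' in auto)
  then show ?thesis by (simp add: D0)
qed

text \<open>The order-dependent part of the normalisation of the spherical harmonics; it decays like
  n^(-k), hence the factor \<open>real N ^ k\<close> in the next lemma.\<close>

definition norm_factor :: "nat \<Rightarrow> nat \<Rightarrow> real" where
  "norm_factor k n = sqrt (fact (n - k) / fact (n + k))"

text \<open>Raising \<open>k\<close> by one multiplies the factor by ((n - k)(n + k + 1))^(-1/2), a
  product of two reciprocal powers.\<close>

lemma symb_norm_factor: "symb m (\<lambda>N n. real N ^ k * norm_factor k n)"
proof (induction k)
  case 0
  then show ?case by (simp add: norm_factor_def symb_const)
next
  case (Suc k)
  have "symb m (\<lambda>N n. (real N ^ k * norm_factor k n) *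
      ((real N / (real n + (- real k))) powr (1/2) * (real N / (real n + (real k + 1))) powr (1/2)))"
    by (intro symb_mult Suc symb_reciprocal_powr) auto
  moreover have "\<forall>\<^sub>F N in sequentially. \<forall>n. N \<le> 4 * n \<longrightarrow> (real N ^ k * norm_factor k n) *
      ((real N / (real n + (- real k))) powr (1/2) * (real N / (real n + (real k + 1))) powr (1/2))
      = real N ^ Suc k * norm_factor (Suc k) n"
    \<comment> \<open>On the window this gives \<open>n \<ge> Suc k\<close>, so the subtractions
      inside the factorials do not truncate.\<close>
    using eventually_ge_at_top[of "4 * k + 4"]
  proof eventually_elim
    case (elim N)
    show ?case
    proof (intro allI impI)
      fix n assume "N \<le> 4 * n"
      then have n: "n \<ge> Suc k" using elim by simp
      then have pos: "real n - real k > 0" by simp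
      have "n - k = Suc (n - Suc k)" using n by simp
      then have f: "(fact (n - k) :: real) = (real n - real k) * fact (n - Suc k)"
        using n by (simp only: fact_Suc) (simp add: of_nat_diff)
      have "norm_factor (Suc k) n
          = norm_factor k n * sqrt (1 / ((real n - real k) * (real n + (real k + 1))))"
        unfolding norm_factor_def f real_sqrt_mult[symmetric] using pos
        by (simp add: divide_simps add_ac)
      moreover have "(real N / (real n + (- real k))) powr (1/2) * (real N / (real n + (real k + 1))) powr (1/2)
          = real N * sqrt (1 / ((real n - real k) * (real n + (real k + 1))))"
        using pos by (simp add: powr_half_sqrt real_sqrt_divide real_sqrt_mult)
      ultimately show "(real N ^ k * norm_factor k n) *
      ((real N / (real n + (- real k))) powr (1/2) * (real N / (real n + (real k + 1))) powr (1/2))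
      = real N ^ Suc k * norm_factor (Suc k) n" by simp
    qed
  qed
  ultimately show ?case by (rule symb_cong[rotated])
qed

text \<open>The factor common to the orders \<open>k\<close> and \<open>-k\<close> of the wavelet
  once phase, power of sin \<theta>, directional coefficient and constant are split off.\<close>

definition wavelet_kernel :: "(real \<Rightarrow> real) \<Rightarrow> nat \<Rightarrow> nat \<Rightarrow> real \<Rightarrow> real" where
  "wavelet_kernel \<kappa> k N x
     = (\<Sum>n\<le>2 * N. (2 * real n + 1) * (\<kappa> (real n / real N) * norm_factor k n) * legendre_deriv k n x)"

lemma window_function_eq_0:
  assumes zero: "\<forall>t\<ge>0. t \<notin> {1/2..2} \<longrightarrow> \<kappa> t = 0" and "2 * n < N \<or> 2 * N < n"
  shows "\<kappa> (real n / real N) = (0::real)"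
\<comment> \<open>For \<open>N = 0\<close> the quotient is 0 by convention, and 0 also lies outside
  the support.\<close>
proof (cases "N = 0")
  case False
  with assms(2) have "real n / real N \<notin> {1/2..2}" by (auto simp: field_simps)
  then show ?thesis using zero by simp
qed (simp add: zero)

text \<open>The factor N^k makes the coefficients bounded and smooth at scale \<open>N\<close>;
  dividing it out again turns N^(2 + 2k) into N^(2 + k).\<close>

lemma wavelet_kernel_decay:
  assumes "Cm_on m {0..} \<kappa>" and zero: "\<forall>t\<ge>0. t \<notin> {1/2..2} \<longrightarrow> \<kappa> t = 0" and "q + 1 \<le> m"
  obtains C where "C \<ge> 0" "\<forall>\<^sub>F N in sequentially. \<forall>\<theta>\<in>{0..pi}.
    (1 + real N * \<theta>) ^ q * \<bar>wavelet_kernel \<kappa> k N (cos \<theta>)\<bar> \<le> C * real N ^ (2 + k)"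
proof -
  \<comment> \<open>The least \<open>M\<close> with \<open>q \<le> 2 * M\<close>; it satisfies
    \<open>2 * M \<le> q + 1\<close>, the available smoothness.\<close>
  define M where "M = (q + 1) div 2"
  define a where "a N n = \<kappa> (real n / real N) * (real N ^ k * norm_factor k n)" for N n
  have "symb m a"
    unfolding a_def[abs_def] by (intro symb_mult symb_norm_factor symb_window_function assms)
  then have a: "symb (2 * M) a" by (rule symb_mono) (use assms(3) in \<open>simp add: M_def\<close>)
  have supp: "a N n = 0" if "2 * n < N \<or> 2 * N < n" for N n
    unfolding a_def using window_function_eq_0[OF zero that] by simp
  have q: "q \<le> 2 * M" by (simp add: M_def)
  obtain C where C: "C \<ge> 0" "\<forall>\<^sub>F N in sequentially. \<forall>\<theta>\<in>{0..pi}.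
    (1 + real N * \<theta>) ^ q * \<bar>\<Sum>n\<le>2 * N. (2 * real n + 1) * a N n * legendre_deriv k n (cos \<theta>)\<bar>
      \<le> C * real N ^ (2 + 2 * k)"
    by (rule legendre_kernel_decay[OF a supp q])
  have "\<forall>\<^sub>F N in sequentially. \<forall>\<theta>\<in>{0..pi}.
    (1 + real N * \<theta>) ^ q * \<bar>wavelet_kernel \<kappa> k N (cos \<theta>)\<bar> \<le> C * real N ^ (2 + k)"
    using C(2) eventually_ge_at_top[of 1]
  proof eventually_elim
    case (elim N)
    show ?case
    proof
      fix \<theta> assume \<theta>: "\<theta> \<in> {0..pi}"
      have "(\<Sum>n\<le>2 * N. (2 * real n + 1) * a N n * legendre_deriv k n (cos \<theta>))
          = real N ^ k * wavelet_kernel \<kappa> k N (cos \<theta>)"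
        by (simp add: a_def wavelet_kernel_def sum_distrib_left mult_ac)
      with elim(1) \<theta> have "(1 + real N * \<theta>) ^ q * \<bar>real N ^ k * wavelet_kernel \<kappa> k N (cos \<theta>)\<bar>
          \<le> C * real N ^ (2 + 2 * k)" by (metis (no_types, lifting))
      moreover have "real N ^ (2 + 2 * k) = real N ^ k * real N ^ (2 + k)"
        by (simp add: power_add mult_2)
      moreover have "\<bar>real N ^ k * wavelet_kernel \<kappa> k N (cos \<theta>)\<bar>
          = real N ^ k * \<bar>wavelet_kernel \<kappa> k N (cos \<theta>)\<bar>" by (simp add: abs_mult)
      ultimately have "real N ^ k * ((1 + real N * \<theta>) ^ q * \<bar>wavelet_kernel \<kappa> k N (cos \<theta>)\<bar>)
          \<le> real N ^ k * (C * real N ^ (2 + k))"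
        by (simp only: mult_ac)
      then show "(1 + real N * \<theta>) ^ q * \<bar>wavelet_kernel \<kappa> k N (cos \<theta>)\<bar> \<le> C * real N ^ (2 + k)"
        using elim(2) by (simp add: mult_le_cancel_left)
    qed
  qed
  with C(1) show ?thesis by (rule that)
qed

text \<open>For \<open>k < 0\<close> the sign in \<^const>\<open>assoc_legendre\<close> cancels the one in \<^const>\<open>sph_harm\<close>.\<close>

definition harm_phase :: "int \<Rightarrow> real \<Rightarrow> complex" where
  "harm_phase k \<phi> = of_real (if 0 \<le> k then (-1) powi k else 1) * exp (\<i> * of_int k * complex_of_real \<phi>)"

lemma norm_harm_phase: "norm (harm_phase k \<phi>) = 1"
proof -
  have "norm (exp (\<i> * of_int k * complex_of_real \<phi>)) = 1"
    by (simp add: norm_exp_eq_Re)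
  then show ?thesis by (simp add: harm_phase_def norm_mult norm_power_int del: norm_exp_eq_Re)
qed

lemma assoc_legendre_nonneg_cos:
  assumes "\<theta> \<in> {0..pi}"
  shows "assoc_legendre_nonneg n l (cos \<theta>) = sin \<theta> ^ l * legendre_deriv l n (cos \<theta>)"
proof -
  have "sqrt (1 - (cos \<theta>)\<^sup>2) = sin \<theta>"
    using assms sin_ge_zero[of \<theta>] by (simp add: sin_squared_eq[symmetric])
  then show ?thesis
    by (simp add: assoc_legendre_nonneg_def legendre_deriv_def legendre_eq_poly deriv_iter_poly)
qed

text \<open>For negative \<open>k\<close> the factorial quotient \<open>r\<close> from
  \<open>assoc_legendre\<close> meets sqrt(1/r) from the normalisation and leaves sqrt r, so both
  signs yield \<open>norm_factor\<close> at |k|.\<close>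

lemma sph_harm_eq:
  assumes "\<bar>k\<bar> \<le> int n" "\<theta> \<in> {0..pi}"
  shows "sph_harm n k \<theta> \<phi> = harm_phase k \<phi> * of_real (sqrt ((2 * real n + 1) / (4 * pi))
    * norm_factor (nat \<bar>k\<bar>) n * sin \<theta> ^ nat \<bar>k\<bar> * legendre_deriv (nat \<bar>k\<bar>) n (cos \<theta>))"
proof (cases "0 \<le> k")
  case True
  then obtain l where k: "k = int l" by (metis nonneg_int_cases)
  have n: "nat (int n - k) = n - l" "nat (int n + k) = n + l" by (auto simp: k)
  show ?thesis
    unfolding sph_harm_def n assoc_legendre_def harm_phase_def norm_factor_def
    unfolding real_sqrt_mult by (simp add: k assoc_legendre_nonneg_cos[OF assms(2)] mult_ac)
next
  case False
  define l where "l = nat (- k)"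
  have k: "k = - int l" "l > 0" using False by (auto simp: l_def)
  have n: "nat (int n - k) = n + l" "nat (int n + k) = n - l" by (auto simp: k)
  define r where "r = (fact (n - l) / fact (n + l) :: real)"
  have r: "r > 0" by (simp add: r_def)
  have r': "fact (n + l) / fact (n - l) = 1 / r" by (simp add: r_def)
  have s: "(-1::real) powi k * (-1) powi k = 1"
    by (simp add: power_int_mult_distrib[symmetric])
  have t: "sqrt (1 / r) * r = sqrt r"
    using r by (simp add: real_sqrt_divide real_div_sqrt)
  have "(-1) powi k * sqrt ((2 * real n + 1) / (4 * pi) * (1 / r))
      * ((-1) powi k * r * (sin \<theta> ^ l * legendre_deriv l n (cos \<theta>)))
    = ((-1) powi k * (-1) powi k) * (sqrt ((2 * real n + 1) / (4 * pi)) * (sqrt (1 / r) * r)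
      * sin \<theta> ^ l * legendre_deriv l n (cos \<theta>))"
    unfolding real_sqrt_mult by (simp only: mult_ac)
  also have "\<dots> = sqrt ((2 * real n + 1) / (4 * pi)) * sqrt r * sin \<theta> ^ l * legendre_deriv l n (cos \<theta>)"
    unfolding s t by simp
  finally have "(-1) powi k * sqrt ((2 * real n + 1) / (4 * pi) * (1 / r))
      * ((-1) powi k * r * (sin \<theta> ^ l * legendre_deriv l n (cos \<theta>)))
    = sqrt ((2 * real n + 1) / (4 * pi)) * sqrt r * sin \<theta> ^ l * legendre_deriv l n (cos \<theta>)" .
  then show ?thesis
    using False unfolding sph_harm_def n assoc_legendre_def harm_phase_def norm_factor_def r'
      assoc_legendre_nonneg_cos[OF assms(2)] r_def[symmetric]
    by (simp add: k(1) r_def mult_ac)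
qed

section \<open>Reduction of the wavelet to finitely many kernels\<close>

text \<open>For \<open>n \<ge> K\<close> both parity branches give p = K - 1; the degree
  \<open>K\<close> serves as representative.\<close>

lemma dir_coeff_eq:
  assumes "K \<le> n" "1 \<le> K"
  shows "dir_coeff K n k = dir_coeff K K k"
proof -
  have "(if even (K + n) then min (int K - 1) (int n - 1) else min (int K - 1) (int n)) = int K - 1" 
    "(if even (K + K) then min (int K - 1) (int K - 1) else min (int K - 1) (int K)) = int K - 1"
    using assms by auto
  then show ?thesis unfolding dir_coeff_def by (simp only:)
qed

lemma dir_wavelet_finite_sum:
  assumes zero: "\<forall>t\<ge>0. t \<notin> {1/2..2} \<longrightarrow> \<kappa> t = 0"
  shows "dir_wavelet \<kappa> K N \<theta> \<phi> = (\<Sum>n\<le>2 * N. \<Sum>k = - int n..int n.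
        complex_of_real (sqrt ((2 * real n + 1) / (8 * pi\<^sup>2)) * \<kappa> (real n / real N))
        * dir_coeff K n k * sph_harm n k \<theta> \<phi>)"
  unfolding dir_wavelet_def
  by (intro suminf_finite sum.neutral ballI) (simp_all add: window_function_eq_0[OF zero])

text \<open>A crude termwise bound depending on \<open>N\<close>, meant for the finitely many
  \<open>N\<close> that the asymptotic estimate does not reach.\<close>

lemma dir_wavelet_bounded:
  assumes zero: "\<forall>t\<ge>0. t \<notin> {1/2..2} \<longrightarrow> \<kappa> t = 0"
  obtains B where "\<And>\<theta> \<phi>. \<theta> \<in> {0..pi} \<Longrightarrow> norm (dir_wavelet \<kappa> K N \<theta> \<phi>) \<le> B"
proof
  fix \<theta> \<phi> assume \<theta>: "\<theta> \<in> {0..pi}"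
  show "norm (dir_wavelet \<kappa> K N \<theta> \<phi>) \<le> (\<Sum>n\<le>2 * N. \<Sum>k = - int n..int n.
      norm (complex_of_real (sqrt ((2 * real n + 1) / (8 * pi\<^sup>2)) * \<kappa> (real n / real N))
        * dir_coeff K n k) * (sqrt ((2 * real n + 1) / (4 * pi)) * norm_factor (nat \<bar>k\<bar>) n
        * real n ^ (2 * nat \<bar>k\<bar>)))"
    unfolding dir_wavelet_finite_sum[OF zero]
  proof (intro sum_norm_le)
    fix n k assume "k \<in> {- int n..int n}"
    then have k: "\<bar>k\<bar> \<le> int n" by auto
    have nf: "norm_factor l n \<ge> 0" for l by (simp add: norm_factor_def)
    have "norm (sph_harm n k \<theta> \<phi>) = sqrt ((2 * real n + 1) / (4 * pi)) * norm_factor (nat \<bar>k\<bar>) n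
        * (\<bar>sin \<theta>\<bar> ^ nat \<bar>k\<bar> * \<bar>legendre_deriv (nat \<bar>k\<bar>) n (cos \<theta>)\<bar>)"
      using nf unfolding sph_harm_eq[OF k \<theta>] norm_mult norm_harm_phase norm_of_real
      by (simp add: power_abs abs_mult)
    also have "\<dots> \<le> sqrt ((2 * real n + 1) / (4 * pi)) * norm_factor (nat \<bar>k\<bar>) n
        * (1 * real n ^ (2 * nat \<bar>k\<bar>))"
      using nf by (intro mult_left_mono mult_mono legendre_deriv_bound power_le_one) auto
    finally show "norm (complex_of_real (sqrt ((2 * real n + 1) / (8 * pi\<^sup>2)) * \<kappa> (real n / real N))
        * dir_coeff K n k * sph_harm n k \<theta> \<phi>)
      \<le> norm (complex_of_real (sqrt ((2 * real n + 1) / (8 * pi\<^sup>2)) * \<kappa> (real n / real N))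
        * dir_coeff K n k) * (sqrt ((2 * real n + 1) / (4 * pi)) * norm_factor (nat \<bar>k\<bar>) n
        * real n ^ (2 * nat \<bar>k\<bar>))"
      unfolding norm_mult[of _ "sph_harm n k \<theta> \<phi>"] by (intro mult_left_mono) auto
  qed
qed

text \<open>If \<open>n < K\<close> then 2n < N and the window function vanishes. Otherwise the
  coefficients are independent of \<open>n\<close> and vanish for |k| \<ge> K, so the two sums can
  be interchanged. The two square roots multiply to (2n + 1) / sqrt(32 pi^3).\<close>

lemma dir_wavelet_eq_kernels:
  assumes zero: "\<forall>t\<ge>0. t \<notin> {1/2..2} \<longrightarrow> \<kappa> t = 0"
    and K: "1 \<le> K" "2 * K \<le> N" and \<theta>: "\<theta> \<in> {0..pi}"
  shows "dir_wavelet \<kappa> K N \<theta> \<phi> = (\<Sum>k = - (int K - 1)..int K - 1. dir_coeff K K k * harm_phase k \<phi>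
    * of_real (sin \<theta> ^ nat \<bar>k\<bar> / sqrt (32 * pi ^ 3) * wavelet_kernel \<kappa> (nat \<bar>k\<bar>) N (cos \<theta>)))"
proof -
  let ?I = "{- (int K - 1)..int K - 1}"
  let ?g = "\<lambda>n k. complex_of_real (sqrt ((2 * real n + 1) / (8 * pi\<^sup>2)) * \<kappa> (real n / real N))
        * dir_coeff K n k * sph_harm n k \<theta> \<phi>"
  let ?h = "\<lambda>n k. dir_coeff K K k * harm_phase k \<phi> * of_real (sin \<theta> ^ nat \<bar>k\<bar> / sqrt (32 * pi ^ 3)
      * ((2 * real n + 1) * (\<kappa> (real n / real N) * norm_factor (nat \<bar>k\<bar>) n) * legendre_deriv (nat \<bar>k\<bar>) n (cos \<theta>)))"
  have inner: "(\<Sum>k = - int n..int n. ?g n k) = (\<Sum>k\<in>?I. ?h n k)" for n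
  proof (cases "K \<le> n")
    case True
    have "(\<Sum>k = - int n..int n. ?g n k) = (\<Sum>k\<in>?I. ?g n k)"
      using True by (intro sum.mono_neutral_right) (auto simp: dir_coeff_def)
    also have "\<dots> = (\<Sum>k\<in>?I. ?h n k)"
    proof (rule sum.cong)
      fix k assume "k \<in> ?I"
      then have k: "\<bar>k\<bar> \<le> int n" using True by auto
      have "sqrt ((2 * real n + 1) / (8 * pi\<^sup>2)) * sqrt ((2 * real n + 1) / (4 * pi))
          = sqrt ((2 * real n + 1)\<^sup>2 / (32 * pi ^ 3))"
        by (simp add: real_sqrt_mult[symmetric] power2_eq_square power3_eq_cube)
      also have "\<dots> = (2 * real n + 1) / sqrt (32 * pi ^ 3)"
        by (simp add: real_sqrt_divide)
      finally have c: "sqrt ((2 * real n + 1) / (8 * pi\<^sup>2)) * sqrt ((2 * real n + 1) / (4 * pi))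
          = (2 * real n + 1) / sqrt (32 * pi ^ 3)" .
      have "?g n k = dir_coeff K K k * harm_phase k \<phi> * of_real (
         (sqrt ((2 * real n + 1) / (8 * pi\<^sup>2)) * sqrt ((2 * real n + 1) / (4 * pi))) * \<kappa> (real n / real N)
         * (norm_factor (nat \<bar>k\<bar>) n * sin \<theta> ^ nat \<bar>k\<bar> * legendre_deriv (nat \<bar>k\<bar>) n (cos \<theta>)))"
        unfolding sph_harm_eq[OF k \<theta>] dir_coeff_eq[OF True K(1)] by (simp only: of_real_mult mult_ac)
      then show "?g n k = ?h n k" unfolding c by (simp add: mult_ac)
    qed simp
    finally show ?thesis .
  next
    case False
    then have "\<kappa> (real n / real N) = 0" using K by (intro window_function_eq_0 zero) auto
    then show ?thesis by simp
  qed
  show ?thesis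
    unfolding dir_wavelet_finite_sum[OF zero] inner
    by (subst sum.swap) (simp add: wavelet_kernel_def sum_distrib_left sum_distrib_right)
qed


section \<open>The decay estimate for large N and its extension to all N\<close>

lemma uniform_constant:
  fixes P :: "real \<Rightarrow> nat \<Rightarrow> bool"
  assumes mono: "\<And>c d N. P c N \<Longrightarrow> c \<le> d \<Longrightarrow> P d N"
    and ev: "\<forall>\<^sub>F N in sequentially. P c N"
    and each: "\<And>N. N \<ge> 1 \<Longrightarrow> \<exists>c. P c N"
  shows "\<exists>c>0. \<forall>N\<ge>1. P c N"
proof -
  obtain N0 where N0: "\<And>N. N \<ge> N0 \<Longrightarrow> P c N"
    using ev unfolding eventually_sequentially by blast
  from each obtain d where d: "\<And>N. N \<ge> 1 \<Longrightarrow> P (d N) N" by metis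
  define e where "e = 1 + \<bar>c\<bar> + (\<Sum>N<N0. \<bar>d N\<bar>)"
  have nn: "(\<Sum>N<N0. \<bar>d N\<bar>) \<ge> 0" by (simp add: sum_nonneg)
  have "P e N" if "N \<ge> 1" for N
  proof (cases "N \<ge> N0")
    case True
    have "c \<le> e" unfolding e_def using nn by linarith
    with N0[OF True] show ?thesis by (rule mono)
  next
    case False
    then have "\<bar>d N\<bar> \<le> (\<Sum>N<N0. \<bar>d N\<bar>)" by (intro member_le_sum) auto
    then have "d N \<le> e" unfolding e_def by linarith
    with d[OF that] show ?thesis by (rule mono)
  qed
  moreover have "e > 0" using nn by (simp add: e_def add_pos_nonneg)
  ultimately show ?thesis by blast
qed

text \<open>Order \<open>k\<close> contributes sin^|k| \<theta> times N^(2 + |k|), that is N^2 (N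
  sin \<theta>)^|k|, which is at most N^2 times the whole sum of nonnegative powers.\<close>

lemma dir_wavelet_decay:
  assumes K: "1 \<le> K" and zero: "\<forall>t\<ge>0. t \<notin> {1/2..2} \<longrightarrow> \<kappa> t = 0"
    and "Cm_on m {0..} \<kappa>" "q + 1 \<le> m"
  obtains c where "\<forall>\<^sub>F N in sequentially. \<forall>\<theta>\<in>{0..pi}. \<forall>\<phi>.
    norm (dir_wavelet \<kappa> K N \<theta> \<phi>)
      \<le> c * (real N)\<^sup>2 / (1 + real N * \<theta>) ^ q * (\<Sum>k = 0..K - 1. (real N * sin \<theta>) ^ k)"
proof -
  have "\<forall>k. \<exists>C\<ge>0. \<forall>\<^sub>F N in sequentially. \<forall>\<theta>\<in>{0..pi}.
    (1 + real N * \<theta>) ^ q * \<bar>wavelet_kernel \<kappa> k N (cos \<theta>)\<bar> \<le> C * real N ^ (2 + k)"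
  proof
    fix k
    show "\<exists>C\<ge>0. \<forall>\<^sub>F N in sequentially. \<forall>\<theta>\<in>{0..pi}.
      (1 + real N * \<theta>) ^ q * \<bar>wavelet_kernel \<kappa> k N (cos \<theta>)\<bar> \<le> C * real N ^ (2 + k)"
      by (rule wavelet_kernel_decay[OF assms(3) zero assms(4), of k]) blast
  qed
  from choice[OF this] obtain C where C: "\<And>k. C k \<ge> 0" and ev: "\<And>k. \<forall>\<^sub>F N in sequentially. \<forall>\<theta>\<in>{0..pi}.
    (1 + real N * \<theta>) ^ q * \<bar>wavelet_kernel \<kappa> k N (cos \<theta>)\<bar> \<le> C k * real N ^ (2 + k)"
    by blast
  define I where "I = {- (int K - 1)..int K - 1}"
  define b where "b k = norm (dir_coeff K K k) / sqrt (32 * pi ^ 3)" for k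
  have b: "b k \<ge> 0" for k by (simp add: b_def)
  define c where "c = (\<Sum>k\<in>I. b k * C (nat \<bar>k\<bar>))"
  have "\<forall>\<^sub>F N in sequentially. \<forall>k\<in>{..<K}. \<forall>\<theta>\<in>{0..pi}.
    (1 + real N * \<theta>) ^ q * \<bar>wavelet_kernel \<kappa> k N (cos \<theta>)\<bar> \<le> C k * real N ^ (2 + k)"
    using ev by (intro eventually_ball_finite) auto
  then have "\<forall>\<^sub>F N in sequentially. \<forall>\<theta>\<in>{0..pi}. \<forall>\<phi>.
    norm (dir_wavelet \<kappa> K N \<theta> \<phi>)
      \<le> c * (real N)\<^sup>2 / (1 + real N * \<theta>) ^ q * (\<Sum>k = 0..K - 1. (real N * sin \<theta>) ^ k)"
    using eventually_ge_at_top[of "2 * K"]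
  proof eventually_elim
    case (elim N)
    show ?case
    proof (intro ballI allI)
      fix \<theta> \<phi> assume \<theta>: "\<theta> \<in> {0..pi}"
      define S where "S = (\<Sum>k = 0..K - 1. (real N * sin \<theta>) ^ k)"
      have sin: "sin \<theta> \<ge> 0" using \<theta> by (simp add: sin_ge_zero)
      have pos: "(1 + real N * \<theta>) ^ q > 0" using \<theta> by (intro zero_less_power add_pos_nonneg) auto
      have "norm (dir_wavelet \<kappa> K N \<theta> \<phi>)
          \<le> (\<Sum>k\<in>I. b k * (sin \<theta> ^ nat \<bar>k\<bar> * \<bar>wavelet_kernel \<kappa> (nat \<bar>k\<bar>) N (cos \<theta>)\<bar>))"
        unfolding dir_wavelet_eq_kernels[OF zero K elim(2) \<theta>] I_def
      proof (rule sum_norm_le)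
        fix k
        show "norm (dir_coeff K K k * harm_phase k \<phi> * of_real (sin \<theta> ^ nat \<bar>k\<bar> / sqrt (32 * pi ^ 3)
            * wavelet_kernel \<kappa> (nat \<bar>k\<bar>) N (cos \<theta>)))
          \<le> b k * (sin \<theta> ^ nat \<bar>k\<bar> * \<bar>wavelet_kernel \<kappa> (nat \<bar>k\<bar>) N (cos \<theta>)\<bar>)"
          unfolding norm_mult norm_harm_phase norm_of_real
          using sin by (simp add: b_def abs_mult)
      qed
      then have "(1 + real N * \<theta>) ^ q * norm (dir_wavelet \<kappa> K N \<theta> \<phi>) \<le> (1 + real N * \<theta>) ^ q *
          (\<Sum>k\<in>I. b k * (sin \<theta> ^ nat \<bar>k\<bar> * \<bar>wavelet_kernel \<kappa> (nat \<bar>k\<bar>) N (cos \<theta>)\<bar>))"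
        using pos by (intro mult_left_mono) auto
      also have "\<dots> = (\<Sum>k\<in>I. b k * (sin \<theta> ^ nat \<bar>k\<bar>
          * ((1 + real N * \<theta>) ^ q * \<bar>wavelet_kernel \<kappa> (nat \<bar>k\<bar>) N (cos \<theta>)\<bar>)))"
        by (simp only: sum_distrib_left mult_ac)
      also have "\<dots> \<le> (\<Sum>k\<in>I. b k * C (nat \<bar>k\<bar>) * ((real N)\<^sup>2 * S))"
      proof (rule sum_mono)
        fix k assume "k \<in> I"
        then have k: "nat \<bar>k\<bar> < K" by (auto simp: I_def)
        have S: "(real N * sin \<theta>) ^ nat \<bar>k\<bar> \<le> S"
          unfolding S_def by (rule member_le_sum) (use k sin in auto)
        have "b k * (sin \<theta> ^ nat \<bar>k\<bar> * ((1 + real N * \<theta>) ^ q * \<bar>wavelet_kernel \<kappa> (nat \<bar>k\<bar>) N (cos \<theta>)\<bar>))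
            \<le> b k * (sin \<theta> ^ nat \<bar>k\<bar> * (C (nat \<bar>k\<bar>) * real N ^ (2 + nat \<bar>k\<bar>)))"
          using elim(1) k \<theta> sin b by (intro mult_left_mono) auto
        also have "\<dots> = b k * C (nat \<bar>k\<bar>) * ((real N)\<^sup>2 * (real N * sin \<theta>) ^ nat \<bar>k\<bar>)"
          by (simp only: power_add power_mult_distrib mult_ac)
        also have "\<dots> \<le> b k * C (nat \<bar>k\<bar>) * ((real N)\<^sup>2 * S)"
          using b C S by (intro mult_left_mono) auto
        finally show "b k * (sin \<theta> ^ nat \<bar>k\<bar> * ((1 + real N * \<theta>) ^ q * \<bar>wavelet_kernel \<kappa> (nat \<bar>k\<bar>) N (cos \<theta>)\<bar>))
            \<le> b k * C (nat \<bar>k\<bar>) * ((real N)\<^sup>2 * S)" .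
      qed
      also have "\<dots> = c * ((real N)\<^sup>2 * S)" by (simp only: c_def sum_distrib_right)
      finally have "norm (dir_wavelet \<kappa> K N \<theta> \<phi>) \<le> c * ((real N)\<^sup>2 * S) / (1 + real N * \<theta>) ^ q"
        using pos by (simp add: pos_le_divide_eq mult.commute)
      then show "norm (dir_wavelet \<kappa> K N \<theta> \<phi>) \<le> c * (real N)\<^sup>2 / (1 + real N * \<theta>) ^ q * S"
        by (simp add: mult_ac)
    qed
  qed
  then show ?thesis by (rule that)
qed

theorem proposition3p1:
  fixes \<kappa> :: "real \<Rightarrow> real" and K q :: nat
  assumes "K \<ge> 1" and "q \<ge> 1"
    and "closure (support_on {0..} \<kappa>) \<noteq> {}"
    and "closure (support_on {0..} \<kappa>) \<subseteq> {1/2..2}"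
    and "Cm_on (3 * q - 1) {0..} \<kappa>"
  shows "(\<exists>c::real. c > 0 \<and>
           (\<forall>N::nat. N \<ge> 1 \<longrightarrow> (\<forall>\<theta>\<in>{0..pi}. \<forall>\<phi>\<in>{0..<2 * pi}.
              norm (dir_wavelet \<kappa> K N \<theta> \<phi>)
                \<le> c * (real N)\<^sup>2 / (1 + real N * \<theta>) ^ q
                    * (\<Sum>k = 0..K - 1. (real N * sin \<theta>) ^ k))))
       \<and> (\<exists>c::real. c > 0 \<and>
           (\<forall>N::nat. N \<ge> 1 \<longrightarrow> (\<forall>\<theta>\<in>{0..pi}. \<forall>\<phi>\<in>{0..<2 * pi}.
              norm (dir_wavelet \<kappa> K N \<theta> \<phi>)
                \<le> c * (real N)\<^sup>2 / (1 + real N * \<theta>) powi (int q + 1 - int K))))"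
proof -
  have zero: "\<forall>t\<ge>0. t \<notin> {1/2..2} \<longrightarrow> \<kappa> t = 0"
  proof (intro allI impI, rule ccontr)
    fix t :: real assume t: "t \<ge> 0" "t \<notin> {1/2..2}" "\<kappa> t \<noteq> 0"
    then have "t \<in> support_on {0..} \<kappa>" by (simp add: support_on_def)
    with assms(4) closure_subset t(2) show False by blast
  qed
  have m: "q + 1 \<le> 3 * q - 1" using assms(2) by simp
  define W where "W N \<theta> = (real N)\<^sup>2 / (1 + real N * \<theta>) ^ q * (\<Sum>k = 0..K - 1. (real N * sin \<theta>) ^ k)" for N \<theta>
  define P where "P c N \<longleftrightarrow> (\<forall>\<theta>\<in>{0..pi}. \<forall>\<phi>. norm (dir_wavelet \<kappa> K N \<theta> \<phi>) \<le> c * W N \<theta>)" for c N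
  have W_nonneg: "W N \<theta> \<ge> 0" if "\<theta> \<in> {0..pi}" for N \<theta>
    unfolding W_def using that by (intro mult_nonneg_nonneg divide_nonneg_nonneg sum_nonneg) (auto simp: sin_ge_zero)
  have W: "c * W N \<theta> = c * (real N)\<^sup>2 / (1 + real N * \<theta>) ^ q
      * (\<Sum>k = 0..K - 1. (real N * sin \<theta>) ^ k)" for c N \<theta>
    by (simp add: W_def)
  obtain c0 where "\<forall>\<^sub>F N in sequentially. P c0 N"
    by (rule dir_wavelet_decay[OF assms(1) zero assms(5) m]) (simp only: P_def W)
  moreover have "P d N" if "P c N" "c \<le> d" for c d N
    unfolding P_def
  proof (intro ballI allI)
    fix \<theta> \<phi> assume \<theta>: "\<theta> \<in> {0..pi}"
    have "norm (dir_wavelet \<kappa> K N \<theta> \<phi>) \<le> c * W N \<theta>" using that(1) \<theta> by (simp add: P_def)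
    also have "\<dots> \<le> d * W N \<theta>" using that(2) W_nonneg[OF \<theta>] by (rule mult_right_mono)
    finally show "norm (dir_wavelet \<kappa> K N \<theta> \<phi>) \<le> d * W N \<theta>" .
  qed
  moreover have "\<exists>c. P c N" if N: "N \<ge> 1" for N
  proof -
    obtain B where B: "\<And>\<theta> \<phi>. \<theta> \<in> {0..pi} \<Longrightarrow> norm (dir_wavelet \<kappa> K N \<theta> \<phi>) \<le> B"
      by (rule dir_wavelet_bounded[OF zero]) blast
    \<comment> \<open>Since \<theta> \<le> pi, N \<ge> 1 and the summand for \<open>k = 0\<close>
      equals 1, the quantity (1 + N pi)^q \<open>W N \<theta>\<close> is at least 1 and can absorb
      any bound.\<close>
    have "norm (dir_wavelet \<kappa> K N \<theta> \<phi>) \<le> \<bar>B\<bar> * (1 + real N * pi) ^ q * W N \<theta>"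
      if \<theta>: "\<theta> \<in> {0..pi}" for \<theta> \<phi>
    proof -
      have "(\<Sum>k\<in>{0}. (real N * sin \<theta>) ^ k) \<le> (\<Sum>k = 0..K - 1. (real N * sin \<theta>) ^ k)"
        by (rule sum_mono2) (use \<theta> in \<open>auto simp: sin_ge_zero\<close>)
      then have S: "1 \<le> (\<Sum>k = 0..K - 1. (real N * sin \<theta>) ^ k)" by simp
      have pos: "0 < (1 + real N * \<theta>) ^ q" using \<theta> by (intro zero_less_power add_pos_nonneg) auto
      have "(1 + real N * \<theta>) ^ q \<le> (1 + real N * pi) ^ q"
        using \<theta> by (intro power_mono add_left_mono mult_left_mono) auto
      moreover define Q where "Q = (1 + real N * pi) ^ q / (1 + real N * \<theta>) ^ q"
      ultimately have "1 \<le> Q" using pos by simp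
      then have "1 * 1 * 1 \<le> Q * (real N)\<^sup>2 * (\<Sum>k = 0..K - 1. (real N * sin \<theta>) ^ k)"
        using S N by (intro mult_mono) auto
      then have "1 \<le> (1 + real N * pi) ^ q * W N \<theta>" by (simp add: W_def Q_def)
      then have "\<bar>B\<bar> * 1 \<le> \<bar>B\<bar> * ((1 + real N * pi) ^ q * W N \<theta>)" by (intro mult_left_mono) auto
      then show ?thesis using B[OF \<theta>, of \<phi>] by (simp add: mult.assoc)
    qed
    then show ?thesis unfolding P_def by blast
  qed
  ultimately have "\<exists>c>0. \<forall>N\<ge>1. P c N" by (intro uniform_constant)
  then obtain c where c: "c > 0" "\<And>N. N \<ge> 1 \<Longrightarrow> P c N" by blast
  have 1: "norm (dir_wavelet \<kappa> K N \<theta> \<phi>) \<le> c * (real N)\<^sup>2 / (1 + real N * \<theta>) ^ q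
      * (\<Sum>k = 0..K - 1. (real N * sin \<theta>) ^ k)"
    if "N \<ge> 1" "\<theta> \<in> {0..pi}" for N \<theta> \<phi>
    using c(2)[OF that(1)] that(2) by (simp only: P_def W)
  \<comment> \<open>As N sin \<theta> \<le> N\<theta> \<le> z, each of the \<open>K\<close> summands
    is at most z^(K - 1); this accounts for the factor \<open>real K\<close> in the
    constant.\<close>
  have 2: "norm (dir_wavelet \<kappa> K N \<theta> \<phi>)
      \<le> (c * real K) * (real N)\<^sup>2 / (1 + real N * \<theta>) powi (int q + 1 - int K)"
    if "N \<ge> 1" and \<theta>: "\<theta> \<in> {0..pi}" for N \<theta> \<phi>
  proof -
    define z where "z = 1 + real N * \<theta>"
    have z: "z \<ge> 1" using \<theta> by (simp add: z_def)
    have "(\<Sum>k = 0..K - 1. (real N * sin \<theta>) ^ k) \<le> (\<Sum>k = 0..K - 1. z ^ (K - 1))"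
    proof (rule sum_mono)
      fix k assume k: "k \<in> {0..K - 1}"
      have "real N * sin \<theta> \<le> real N * \<theta>"
        using \<theta> by (intro mult_left_mono sin_x_le_x) auto
      then have "(real N * sin \<theta>) ^ k \<le> z ^ k"
        using \<theta> by (intro power_mono) (auto simp: z_def sin_ge_zero)
      also have "\<dots> \<le> z ^ (K - 1)" using z k by (intro power_increasing) auto
      finally show "(real N * sin \<theta>) ^ k \<le> z ^ (K - 1)" .
    qed
    then have "c * (real N)\<^sup>2 / z ^ q * (\<Sum>k = 0..K - 1. (real N * sin \<theta>) ^ k)
        \<le> c * (real N)\<^sup>2 / z ^ q * (real K * z ^ (K - 1))"
      using c(1) z assms(1) by (intro mult_left_mono) auto
    also have "\<dots> = (c * real K) * (real N)\<^sup>2 / z powi (int q + 1 - int K)"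
    proof -
      \<comment> \<open>The exponent is an integer that is negative for K > q + 1;
        \<open>K \<ge> 1\<close> allows passing to the natural number \<open>K - 1\<close>.\<close>
      have "z powi (int q + 1 - int K) = z powi (int q - int (K - 1))"
        using assms(1) by (simp add: of_nat_diff algebra_simps)
      also have "\<dots> = z ^ q / z ^ (K - 1)" using z by (simp add: power_int_diff)
      finally show ?thesis by simp
    qed
    finally show ?thesis using 1[OF that, of \<phi>] by (simp add: z_def)
  qed
  show ?thesis
  proof
    show "\<exists>c>0. \<forall>N\<ge>1. \<forall>\<theta>\<in>{0..pi}. \<forall>\<phi>\<in>{0..<2 * pi}. norm (dir_wavelet \<kappa> K N \<theta> \<phi>)
        \<le> c * (real N)\<^sup>2 / (1 + real N * \<theta>) ^ q * (\<Sum>k = 0..K - 1. (real N * sin \<theta>) ^ k)"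
      using 1 c(1) by blast
    show "\<exists>c>0. \<forall>N\<ge>1. \<forall>\<theta>\<in>{0..pi}. \<forall>\<phi>\<in>{0..<2 * pi}. norm (dir_wavelet \<kappa> K N \<theta> \<phi>)
        \<le> c * (real N)\<^sup>2 / (1 + real N * \<theta>) powi (int q + 1 - int K)"
      using 2 c(1) assms(1) by (intro exI[of _ "c * real K"]) auto
  qed
qed

end
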